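(* Let $n$ be a positive integer, $\mathbf n=\{1,\dots,n\}$, and let $\mathscr T_n$ be the full transformation monoid on $\mathbf n$. The normal category $\mathbb L(\mathscr T_n)$ is isomorphic to the full powerset category $\mathbb P$, as bounded above categories.
   Context: Conventions. Mappings, morphisms and functors are composed from left to right ($fg$ means first $f$, then $g$). For a category $\mathcal C$, $v\mathcal C$ denotes its class of objects and $\mathcal C(c,c')$ the set of morphisms from $c$ to $c'$. A monomorphism is a right cancellable morphism and an epimorphism is a left cancellable morphism. A semigroup $S$ is regular if for every $a\in S$ there is $x\in S$ with $axa=a$; $E(S)$ is its set of idempotents. $\mathscr T_n$ is the (regular) monoid of all maps $\mathbf n\to\mathbf n$ under composition. Normal categories. A strict preorder is a category with at most one morphism between any two (possibly equal) objects in which the only isomorphisms are identities. A category with subobjects is a small category $\mathcal C$ with a subcategory $\mathcal P$ such that: $\mathcal P$ is a strict preorder with $v\mathcal P=v\mathcal C$; every $f\in\mathcal P$ is a monomorphism in $\mathcal C$; if $f,g\in\mathcal P$ and $f=hg$ with $h\in\mathcal C$, then $h\in\mathcal P$. Morphisms of $\mathcal P$ are called inclusions; $c\preceq c'$ means $\mathcal P(c,c')\neq\emptyset$, and $j(c,c')$ is then the unique inclusion. An inclusion $j\colon c\to c'$ splits if there is $q\colon c'\to c$ in $\mathcal C$ with $jq=1_c$; such a $q$ is called a retraction. A normal factorisation of a morphism $f$ is $f=quj$ with $q$ a retraction, $u$ an isomorphism, $j$ an inclusion. A cone with vertex $z\in v\mathcal C$ is a map $\gamma$ assigning to each $c\in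 v\mathcal C$ a morphism $\gamma(c)\in\mathcal C(c,z)$ such that $j(a,b)\gamma(b)=\gamma(a)$ whenever $a\preceq b$, and $\gamma(c)$ is an isomorphism for at least one $c$; the vertex is denoted $z_\gamma$. $\mathcal C$ is a normal category if it is a category with subobjects in which every inclusion splits, every morphism has a normal factorisation, and for each $c\in v\mathcal C$ there is a cone $\mu$ with vertex $c$ and $\mu(c)=1_c$. In a normal category, for a normal factorisation $f=quj$ the epimorphism $f^\circ:=qu$ does not depend on the factorisation. A normal category $\mathcal C$ is bounded above if there is $d\in v\mathcal C$ with $c\preceq d$ for every $c\in v\mathcal C$. Semigroup of cones. For a cone $\gamma$ and an epimorphism $f$ with domain $z_\gamma$, $\gamma\ast f$ is the cone $c\mapsto\gamma(c)f$. The set $\widehat{\mathcal C}$ of all cones in a normal category $\mathcal C$ is a regular semigroup under $\gamma\cdot\delta=\gamma\ast(\delta(z_\gamma))^\circ$. Let $\mathscr R$ be Green's relation on $\widehat{\mathcal C}$, $R_\gamma$ the $\mathscr R$-class of $\gamma$; $\widehat{\mathcal C}/\mathscr R$ is partially ordered by $R_\gamma\sqsubseteq R_\delta$ iff the principal right ideal generated by $\gamma$ is contained in that generated by $\delta$. CC-morphisms. An object $c$ of a normal category $\mathcal C$ is connected to $\mathfrak d\in\mathfrak D:=\widehat{\mathcal C}/\mathscr R$ if $\mathfrak d$ contains an idempotent cone with vertex $c$; this cone is then unique and is denoted $\epsilon(c,\mathfrak d)$. For normal categories $\mathcal C,\mathcal C'$ with $\mathfrak D=\widehat{\mathcal C}/\mathscr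 R$, $\mathfrak D'=\widehat{\mathcal C'}/\mathscr R$, a CC-morphism is a pair $(F,G)$ where $F\colon\mathcal C\to\mathcal C'$ is an inclusion preserving functor and $G\colon\mathfrak D\to\mathfrak D'$ is an order preserving map such that whenever $c$ is connected to $\mathfrak d$, $F(c)$ is connected to $G(\mathfrak d)$ and $F(\epsilon(c,\mathfrak d)(c'))=\epsilon(F(c),G(\mathfrak d))(F(c'))$ for every $c'\in v\mathcal C$. "Isomorphic as bounded above categories" means isomorphic in the category of bounded above normal categories with CC-morphisms. The categories involved. For a regular semigroup $S$, $\mathbb L(S)$ is the category whose objects are the principal left ideals $Se$ ($e\in E(S)$) and whose morphisms from $Se$ to $Sf$ are the mappings $r(e,u,f)\colon Se\to Sf$, $x\mapsto xu$, for $u\in eSf$, composed as maps; its inclusions are the morphisms $r(e,e,f)$ for $Se\subseteq Sf$; it is a normal category. $\mathbb P$ is the category whose objects are the non-empty subsets of $\mathbf n$ and whose morphisms from $A$ to $B$ are all maps $A\to B$; its inclusions are the set inclusion maps. It is a normal category with largest object $\mathbf n$. The poset $\widehat{\mathbb P}/\mathscr R$ is identified with the poset $\Pi$ of all partitions (equivalence relations) of $\mathbf n$ ordered by reverse inclusion, via $R_\gamma\mapsto\{(x,y)\in\mathbf n\times\mathbf n: x\gamma(\mathbf n)=y\gamma(\mathbf n)\}$. *)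

theory Defs
  imports Main "HOL-Library.FuncSet"
begin

text \<open>Throughout, composition is written from left to right: \<open>f \<cdot> g\<close> is first \<open>f\<close>, then \<open>g\<close>.\<close>

section \<open>Categories with subobjects and normal categories\<close>

text \<open>
  A small category together with a distinguished set \<open>Inc\<close> of arrows, intended to be
  the arrows of the subcategory of inclusions. Hom-sets are automatically disjoint, since every
  arrow carries its domain and codomain. \<open>Comp f g\<close> is meaningful only when
  \<open>Cod f = Dom g\<close>.
\<close>

record ('o, 'm) cat =
  Obj :: "'o set"
  Arr :: "'m set"
  Dom :: "'m \<Rightarrow> 'o"
  Cod :: "'m \<Rightarrow> 'o"
  Id :: "'o \<Rightarrow> 'm"
  Comp :: "'m \<Rightarrow> 'm \<Rightarrow> 'm" (infixl "\<cdot>\<index>" 70)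
  Inc :: "'m set"

definition hom_set :: "('o, 'm) cat \<Rightarrow> 'o \<Rightarrow> 'o \<Rightarrow> 'm set" where
  "hom_set C a b = {f \<in> Arr C. Dom C f = a \<and> Cod C f = b}"

locale category =
  fixes C :: "('o, 'm) cat" (structure)
  assumes Dom_in_Obj: "f \<in> Arr C \<Longrightarrow> Dom C f \<in> Obj C"
    and Cod_in_Obj: "f \<in> Arr C \<Longrightarrow> Cod C f \<in> Obj C"
    and Id_in_hom: "c \<in> Obj C \<Longrightarrow> Id C c \<in> hom_set C c c"
    and Comp_in_hom: "\<lbrakk>f \<in> hom_set C a b; g \<in> hom_set C b c\<rbrakk> \<Longrightarrow> f \<cdot> g \<in> hom_set C a c"
    and Id_Comp: "f \<in> hom_set C a b \<Longrightarrow> Id C a \<cdot> f = f"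
    and Comp_Id: "f \<in> hom_set C a b \<Longrightarrow> f \<cdot> Id C b = f"
    and Comp_assoc: "\<lbrakk>f \<in> hom_set C a b; g \<in> hom_set C b c; h \<in> hom_set C c d\<rbrakk>
                      \<Longrightarrow> (f \<cdot> g) \<cdot> h = f \<cdot> (g \<cdot> h)"

definition monomorphism :: "('o, 'm) cat \<Rightarrow> 'm \<Rightarrow> bool" where
  "monomorphism C f \<longleftrightarrow> f \<in> Arr C \<and>
     (\<forall>a. \<forall>g\<in>hom_set C a (Dom C f). \<forall>h\<in>hom_set C a (Dom C f).
        g \<cdot>\<^bsub>C\<^esub> f = h \<cdot>\<^bsub>C\<^esub> f \<longrightarrow> g = h)"

definition isomorphism :: "('o, 'm) cat \<Rightarrow> 'm \<Rightarrow> bool" where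
  "isomorphism C f \<longleftrightarrow> f \<in> Arr C \<and>
     (\<exists>g\<in>hom_set C (Cod C f) (Dom C f).
        f \<cdot>\<^bsub>C\<^esub> g = Id C (Dom C f) \<and> g \<cdot>\<^bsub>C\<^esub> f = Id C (Cod C f))"

text \<open>
  The first five assumptions say that \<open>Inc\<close> is the set of arrows of a subcategory
  which contains all objects and is a strict preorder; in \<open>Inc_iso\<close>, isomorphisms
  are those of the subcategory.
\<close>

locale category_with_subobjects = category +
  assumes Inc_subset: "Inc C \<subseteq> Arr C"
    and Id_in_Inc: "c \<in> Obj C \<Longrightarrow> Id C c \<in> Inc C"
    and Comp_in_Inc: "\<lbrakk>f \<in> Inc C; g \<in> Inc C; Cod C f = Dom C g\<rbrakk> \<Longrightarrow> f \<cdot> g \<in> Inc C"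
    and Inc_unique: "\<lbrakk>f \<in> Inc C; g \<in> Inc C; Dom C f = Dom C g; Cod C f = Cod C g\<rbrakk> \<Longrightarrow> f = g"
    and Inc_iso: "\<lbrakk>f \<in> Inc C; g \<in> Inc C; Dom C g = Cod C f; Cod C g = Dom C f;
                   f \<cdot> g = Id C (Dom C f); g \<cdot> f = Id C (Cod C f)\<rbrakk> \<Longrightarrow> f = Id C (Dom C f)"
    and Inc_mono: "f \<in> Inc C \<Longrightarrow> monomorphism C f"
    and Inc_factor: "\<lbrakk>f \<in> Inc C; g \<in> Inc C; h \<in> Arr C; Cod C h = Dom C g; f = h \<cdot> g\<rbrakk>
                      \<Longrightarrow> h \<in> Inc C"

definition subobject :: "('o, 'm) cat \<Rightarrow> 'o \<Rightarrow> 'o \<Rightarrow> bool" where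
  "subobject C a b \<longleftrightarrow> hom_set C a b \<inter> Inc C \<noteq> {}"

definition inclusion :: "('o, 'm) cat \<Rightarrow> 'o \<Rightarrow> 'o \<Rightarrow> 'm" where
  "inclusion C a b = (THE j. j \<in> hom_set C a b \<inter> Inc C)"

definition retraction_of :: "('o, 'm) cat \<Rightarrow> 'm \<Rightarrow> 'm \<Rightarrow> bool" where
  "retraction_of C j q \<longleftrightarrow> j \<in> Inc C \<and> q \<in> hom_set C (Cod C j) (Dom C j) \<and>
     j \<cdot>\<^bsub>C\<^esub> q = Id C (Dom C j)"

definition splits :: "('o, 'm) cat \<Rightarrow> 'm \<Rightarrow> bool" where
  "splits C j \<longleftrightarrow> (\<exists>q. retraction_of C j q)"

definition retraction :: "('o, 'm) cat \<Rightarrow> 'm \<Rightarrow> bool" where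
  "retraction C q \<longleftrightarrow> (\<exists>j. retraction_of C j q)"

definition normal_factorisation :: "('o, 'm) cat \<Rightarrow> 'm \<Rightarrow> 'm \<Rightarrow> 'm \<Rightarrow> 'm \<Rightarrow> bool" where
  "normal_factorisation C f q u j \<longleftrightarrow>
     retraction C q \<and> isomorphism C u \<and> j \<in> Inc C \<and>
     Cod C q = Dom C u \<and> Cod C u = Dom C j \<and> f = (q \<cdot>\<^bsub>C\<^esub> u) \<cdot>\<^bsub>C\<^esub> j"

text \<open>
  A cone is made \<^const>\<open>undefined\<close> outside the objects of the category, so that equality of
  cones is equality of functions in HOL.
\<close>

definition cone :: "('o, 'm) cat \<Rightarrow> 'o \<Rightarrow> ('o \<Rightarrow> 'm) \<Rightarrow> bool" where
  "cone C z \<gamma> \<longleftrightarrow> z \<in> Obj C \<and> \<gamma> \<in> extensional (Obj C) \<and>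
     (\<forall>c\<in>Obj C. \<gamma> c \<in> hom_set C c z) \<and>
     (\<forall>a\<in>Obj C. \<forall>b\<in>Obj C. subobject C a b \<longrightarrow> inclusion C a b \<cdot>\<^bsub>C\<^esub> \<gamma> b = \<gamma> a) \<and>
     (\<exists>c\<in>Obj C. isomorphism C (\<gamma> c))"

locale normal_category = category_with_subobjects +
  assumes Inc_splits: "j \<in> Inc C \<Longrightarrow> splits C j"
    and ex_normal_factorisation: "f \<in> Arr C \<Longrightarrow> \<exists>q u j. normal_factorisation C f q u j"
    and ex_cone: "c \<in> Obj C \<Longrightarrow> \<exists>\<mu>. cone C c \<mu> \<and> \<mu> c = Id C c"

locale bounded_above_normal_category = normal_category +
  assumes bounded_above: "\<exists>d\<in>Obj C. \<forall>c\<in>Obj C. subobject C c d"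

section \<open>Semigroups and Green's relation R\<close>

record 'a sgrp =
  Elems :: "'a set"
  Mult :: "'a \<Rightarrow> 'a \<Rightarrow> 'a"

definition idempotents :: "'a sgrp \<Rightarrow> 'a set" where
  "idempotents S = {e \<in> Elems S. Mult S e e = e}"

definition right_ideal :: "'a sgrp \<Rightarrow> 'a \<Rightarrow> 'a set" where
  "right_ideal S a = insert a (Mult S a ` Elems S)"

definition green_R :: "'a sgrp \<Rightarrow> ('a \<times> 'a) set" where
  "green_R S = {(a, b). a \<in> Elems S \<and> b \<in> Elems S \<and> right_ideal S a = right_ideal S b}"

definition R_classes :: "'a sgrp \<Rightarrow> 'a set set" where
  "R_classes S = Elems S // green_R S"

definition R_le :: "'a sgrp \<Rightarrow> 'a set \<Rightarrow> 'a set \<Rightarrow> bool" where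
  "R_le S X Y \<longleftrightarrow> (\<exists>a\<in>X. \<exists>b\<in>Y. right_ideal S a \<subseteq> right_ideal S b)"

section \<open>The semigroup of cones\<close>

definition vertex :: "('o, 'm) cat \<Rightarrow> ('o \<Rightarrow> 'm) \<Rightarrow> 'o" where
  "vertex C \<gamma> = (THE z. cone C z \<gamma>)"

text \<open>The epimorphism \<open>f\<^sup>\<circ> = q u\<close>, for a normal factorisation \<open>f = q u j\<close>; in a normal category it
  does not depend on the factorisation.\<close>

definition epi_part :: "('o, 'm) cat \<Rightarrow> 'm \<Rightarrow> 'm" where
  "epi_part C f = (THE e. \<exists>q u j. normal_factorisation C f q u j \<and> e = q \<cdot>\<^bsub>C\<^esub> u)"

definition cone_star :: "('o, 'm) cat \<Rightarrow> ('o \<Rightarrow> 'm) \<Rightarrow> 'm \<Rightarrow> ('o \<Rightarrow> 'm)" where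
  "cone_star C \<gamma> f = (\<lambda>c\<in>Obj C. \<gamma> c \<cdot>\<^bsub>C\<^esub> f)"

definition cone_sgrp :: "('o, 'm) cat \<Rightarrow> ('o \<Rightarrow> 'm) sgrp" where
  "cone_sgrp C =
     \<lparr>Elems = {\<gamma>. \<exists>z. cone C z \<gamma>},
      Mult = (\<lambda>\<gamma> \<delta>. cone_star C \<gamma> (epi_part C (\<delta> (vertex C \<gamma>))))\<rparr>"

section \<open>CC-morphisms\<close>

abbreviation cone_classes :: "('o, 'm) cat \<Rightarrow> ('o \<Rightarrow> 'm) set set" where
  "cone_classes C \<equiv> R_classes (cone_sgrp C)"

definition idempotent_cone_in ::
    "('o, 'm) cat \<Rightarrow> 'o \<Rightarrow> ('o \<Rightarrow> 'm) set \<Rightarrow> ('o \<Rightarrow> 'm) \<Rightarrow> bool" where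
  "idempotent_cone_in C c d \<gamma> \<longleftrightarrow>
     \<gamma> \<in> d \<and> \<gamma> \<in> idempotents (cone_sgrp C) \<and> vertex C \<gamma> = c"

definition connected_to :: "('o, 'm) cat \<Rightarrow> 'o \<Rightarrow> ('o \<Rightarrow> 'm) set \<Rightarrow> bool" where
  "connected_to C c d \<longleftrightarrow>
     c \<in> Obj C \<and> d \<in> cone_classes C \<and> (\<exists>\<gamma>. idempotent_cone_in C c d \<gamma>)"

definition idem_cone :: "('o, 'm) cat \<Rightarrow> 'o \<Rightarrow> ('o \<Rightarrow> 'm) set \<Rightarrow> ('o \<Rightarrow> 'm)" where
  "idem_cone C c d = (THE \<gamma>. idempotent_cone_in C c d \<gamma>)"

text \<open>A functor is given by its object map \<open>Fo\<close> and its arrow map \<open>Fa\<close>.\<close>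

locale inclusion_preserving_functor =
  fixes C :: "('o, 'm) cat" and C' :: "('p, 'k) cat"
    and Fo :: "'o \<Rightarrow> 'p" and Fa :: "'m \<Rightarrow> 'k"
  assumes F_Obj: "c \<in> Obj C \<Longrightarrow> Fo c \<in> Obj C'"
    and F_hom: "f \<in> hom_set C a b \<Longrightarrow> Fa f \<in> hom_set C' (Fo a) (Fo b)"
    and F_Id: "c \<in> Obj C \<Longrightarrow> Fa (Id C c) = Id C' (Fo c)"
    and F_Comp: "\<lbrakk>f \<in> hom_set C a b; g \<in> hom_set C b c\<rbrakk> \<Longrightarrow> Fa (f \<cdot>\<^bsub>C\<^esub> g) = Fa f \<cdot>\<^bsub>C'\<^esub> Fa g"
    and F_Inc: "f \<in> Inc C \<Longrightarrow> Fa f \<in> Inc C'"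

locale CC_morphism = inclusion_preserving_functor +
  fixes G :: "('a \<Rightarrow> 'b) set \<Rightarrow> ('c \<Rightarrow> 'd) set"
  assumes G_classes: "d \<in> cone_classes C \<Longrightarrow> G d \<in> cone_classes C'"
    and G_mono: "\<lbrakk>d \<in> cone_classes C; e \<in> cone_classes C; R_le (cone_sgrp C) d e\<rbrakk>
                  \<Longrightarrow> R_le (cone_sgrp C') (G d) (G e)"
    and FG_connected: "connected_to C c d \<Longrightarrow> connected_to C' (Fo c) (G d)"
    and FG_idem_cone: "\<lbrakk>connected_to C c d; c' \<in> Obj C\<rbrakk>
                  \<Longrightarrow> Fa (idem_cone C c d c') = idem_cone C' (Fo c) (G d) (Fo c')"

text \<open>
  Isomorphism in the category of bounded above normal categories with CC-morphisms, whose
  composition and identities are componentwise. Equality of CC-morphisms means agreement on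
  objects, on arrows, and on classes of cones.
\<close>

definition isomorphic_bounded_above :: "('o, 'm) cat \<Rightarrow> ('p, 'k) cat \<Rightarrow> bool" where
  "isomorphic_bounded_above C C' \<longleftrightarrow>
     bounded_above_normal_category C \<and> bounded_above_normal_category C' \<and>
     (\<exists>Fo Fa G Fo' Fa' G'.
        CC_morphism C C' Fo Fa G \<and> CC_morphism C' C Fo' Fa' G' \<and>
        (\<forall>c\<in>Obj C. Fo' (Fo c) = c) \<and> (\<forall>c\<in>Obj C'. Fo (Fo' c) = c) \<and>
        (\<forall>f\<in>Arr C. Fa' (Fa f) = f) \<and> (\<forall>f\<in>Arr C'. Fa (Fa' f) = f) \<and>
        (\<forall>d\<in>cone_classes C. G' (G d) = d) \<and> (\<forall>d\<in>cone_classes C'. G (G' d) = d))"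

section \<open>Categories of sets and maps\<close>

text \<open>
  A map \<open>A \<rightarrow> B\<close> is encoded as a triple \<open>(A, f, B)\<close> with \<open>f \<in> A \<rightarrow>\<^sub>E B\<close>.
\<close>

type_synonym 'a map_arrow = "'a set \<times> ('a \<Rightarrow> 'a) \<times> 'a set"

definition map_cat :: "'a set set \<Rightarrow> 'a map_arrow set \<Rightarrow> 'a map_arrow set
    \<Rightarrow> ('a set, 'a map_arrow) cat" where
  "map_cat Ob Ar In =
     \<lparr>Obj = Ob, Arr = Ar,
      Dom = (\<lambda>(A, f, B). A), Cod = (\<lambda>(A, f, B). B),
      Id = (\<lambda>A. (A, (\<lambda>x\<in>A. x), A)),
      Comp = (\<lambda>(A, f, B) (B', g, D). (A, (\<lambda>x\<in>A. g (f x)), D)),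
      Inc = In\<rparr>"

definition left_ideal :: "'a sgrp \<Rightarrow> 'a \<Rightarrow> 'a set" where
  "left_ideal S e = (\<lambda>s. Mult S s e) ` Elems S"

definition right_translation :: "'a sgrp \<Rightarrow> 'a \<Rightarrow> 'a \<Rightarrow> 'a \<Rightarrow> 'a map_arrow" where
  "right_translation S e u f = (left_ideal S e, (\<lambda>x\<in>left_ideal S e. Mult S x u), left_ideal S f)"

definition L_cat :: "'a sgrp \<Rightarrow> ('a set, 'a map_arrow) cat" where
  "L_cat S = map_cat
     (left_ideal S ` idempotents S)
     {right_translation S e u f | e u f. e \<in> idempotents S \<and> f \<in> idempotents S \<and>
        u \<in> (\<lambda>s. Mult S (Mult S e s) f) ` Elems S}
     {right_translation S e e f | e f. e \<in> idempotents S \<and> f \<in> idempotents S \<and>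
        left_ideal S e \<subseteq> left_ideal S f}"

definition full_transformation_monoid :: "nat \<Rightarrow> (nat \<Rightarrow> nat) sgrp" where
  "full_transformation_monoid n =
     \<lparr>Elems = {1..n} \<rightarrow>\<^sub>E {1..n}, Mult = (\<lambda>f g. \<lambda>x\<in>{1..n}. g (f x))\<rparr>"

definition powerset_cat :: "nat \<Rightarrow> (nat set, nat map_arrow) cat" where
  "powerset_cat n = map_cat
     (Pow {1..n} - {{}})
     {(A, f, B) | A f B. A \<in> Pow {1..n} - {{}} \<and> B \<in> Pow {1..n} - {{}} \<and> f \<in> A \<rightarrow>\<^sub>E B}
     {(A, (\<lambda>x\<in>A. x), B) | A B. A \<in> Pow {1..n} - {{}} \<and> B \<in> Pow {1..n} - {{}} \<and> A \<subseteq> B}"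

end

theory Submission
  imports Defs
begin

text \<open>
  The principal left ideal of \<open>\<T>\<^sub>n\<close> generated by \<open>e\<close> consists of all maps into the image \<open>A\<close> of \<open>e\<close>,
  and every right translation between two such ideals is postcomposition with a unique map
  \<open>A \<rightarrow> B\<close> between the images. So \<open>A\<close> goes to the ideal of maps into \<open>A\<close>, and \<open>g\<close> to postcomposition
  with \<open>g\<close>; this is a bijection on objects, arrows and inclusions.

  An isomorphism of categories with subobjects carries everything else along. Two
  uniqueness facts are needed, because \<open>f\<^sup>\<circ>\<close> and \<open>\<epsilon>(c,\<dd>)\<close> are definite descriptions: the epimorphism
  \<open>f\<^sup>\<circ>\<close> is unique since two factorisations of \<open>f\<close> into a split epimorphism and an inclusion have
  inclusions that factor through each other; an idempotent cone is the identity at its vertex \<open>c\<close>, so if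
  \<open>\<gamma> = \<delta> * e\<close> for idempotent cones with vertex \<open>c\<close>, then evaluation at \<open>c\<close> gives \<open>e = 1\<close>.
\<close>

section \<open>Normal categories\<close>

lemma hom_setD:
  assumes "f \<in> hom_set C a b"
  shows "f \<in> Arr C" "Dom C f = a" "Cod C f = b"
  using assms by (auto simp: hom_set_def)

lemma Arr_in_hom: "f \<in> Arr C \<Longrightarrow> f \<in> hom_set C (Dom C f) (Cod C f)"
  by (simp add: hom_set_def)

lemma (in category) hom_Obj:
  assumes "f \<in> hom_set C a b"
  shows "a \<in> Obj C" "b \<in> Obj C"
  using assms Dom_in_Obj Cod_in_Obj by (auto simp: hom_set_def)

lemma (in category) isomorphism_Id:
  assumes "c \<in> Obj C"
  shows "isomorphism C (Id C c)"
proof -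
  note Id = Id_in_hom[OF assms]
  then show ?thesis
    unfolding isomorphism_def using Id_Comp[OF Id] hom_setD[OF Id] by (auto intro!: bexI[of _ "Id C c"])
qed

lemma (in category_with_subobjects) inclusion_eqI:
  "\<lbrakk>j \<in> hom_set C a b; j \<in> Inc C\<rbrakk> \<Longrightarrow> inclusion C a b = j"
  unfolding inclusion_def using Inc_unique by (intro the_equality) (auto simp: hom_set_def)

lemma (in category_with_subobjects) inclusion_in:
  assumes "subobject C a b"
  shows "inclusion C a b \<in> hom_set C a b" "inclusion C a b \<in> Inc C"
  using assms inclusion_eqI unfolding subobject_def by (metis IntE equals0I)+

lemma (in category_with_subobjects) Inc_endo:
  assumes "j \<in> Inc C" "j \<in> hom_set C a a"
  shows "j = Id C a"
proof (rule Inc_unique)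
  have a: "a \<in> Obj C"
    using assms(2) by (rule hom_Obj)
  then show "Id C a \<in> Inc C"
    by (rule Id_in_Inc)
  show "Dom C j = Dom C (Id C a)" "Cod C j = Cod C (Id C a)"
    using assms(2) Id_in_hom[OF a] by (auto simp: hom_set_def)
qed fact

text \<open>The composites \<open>h \<cdot> k\<close> and \<open>k \<cdot> h\<close> are inclusions
  of an object into itself, hence identities. So \<open>h\<close> is an isomorphism in the strict
  preorder of inclusions, hence an identity, and its ends agree.\<close>

lemma (in category_with_subobjects) Inc_antisym:
  assumes "h \<in> Inc C" "h \<in> hom_set C a b" "k \<in> Inc C" "k \<in> hom_set C b a"
  shows "b = a" "h = Id C a"
proof -
  have "h \<cdot> k \<in> Inc C" "k \<cdot> h \<in> Inc C"
    using assms by (auto intro!: Comp_in_Inc simp: hom_set_def)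
  moreover have "h \<cdot> k \<in> hom_set C a a" "k \<cdot> h \<in> hom_set C b b"
    using assms Comp_in_hom by blast+
  ultimately have "h \<cdot> k = Id C a" "k \<cdot> h = Id C b"
    by (auto intro: Inc_endo)
  then show h: "h = Id C a"
    using Inc_iso[of h k] assms by (simp add: hom_set_def)
  have "Id C a \<in> hom_set C a a"
    using hom_Obj(1)[OF assms(2)] by (rule Id_in_hom)
  then show "b = a"
    using assms(2) unfolding h hom_set_def by simp
qed

section \<open>Uniqueness of the epimorphism in a normal factorisation\<close>

lemma (in category_with_subobjects) Inc_cancel:
  assumes "j \<in> Inc C" "j \<in> hom_set C b c" "f \<in> hom_set C a b" "g \<in> hom_set C a b"
    and "f \<cdot> j = g \<cdot> j"
  shows "f = g"
proof -
  have "f \<in> hom_set C a (Dom C j)" "g \<in> hom_set C a (Dom C j)"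
    using assms(2-4) by (auto simp: hom_set_def)
  then show ?thesis
    using Inc_mono[OF assms(1)] assms(5) unfolding monomorphism_def by blast
qed

text \<open>If \<open>q\<close> retracts the inclusion \<open>i\<close> and \<open>v\<close> is the
  inverse of \<open>u\<close>, then \<open>s = v \<cdot> i\<close> satisfies
  \<open>s \<cdot> (q \<cdot> u) = v \<cdot> u = Id C b\<close>. The uniqueness argument uses only
  this form: a split epimorphism followed by an inclusion.\<close>

lemma (in category_with_subobjects) normal_factorisation_split_epi:
  assumes "normal_factorisation C f q u j"
  obtains a b c s where "f \<in> hom_set C a c" "q \<cdot> u \<in> hom_set C a b" "j \<in> hom_set C b c"
    "j \<in> Inc C" "f = (q \<cdot> u) \<cdot> j" "s \<in> hom_set C b a" "s \<cdot> (q \<cdot> u) = Id C b"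
proof -
  from assms have u: "isomorphism C u" and j: "j \<in> Inc C" and f: "f = (q \<cdot> u) \<cdot> j"
    and qu: "Cod C q = Dom C u" and uj: "Cod C u = Dom C j"
    unfolding normal_factorisation_def by auto
  from assms obtain i where i: "i \<in> Inc C" and q: "q \<in> hom_set C (Cod C i) (Dom C i)"
    and iq: "i \<cdot> q = Id C (Dom C i)"
    unfolding normal_factorisation_def retraction_def retraction_of_def by blast
  define a b c d where "a = Cod C i" and "b = Dom C j" and "c = Cod C j" and "d = Dom C i"
  from u uj qu q obtain v where v: "v \<in> hom_set C b d" and vu: "v \<cdot> u = Id C b"
    unfolding isomorphism_def b_def d_def by (auto dest: hom_setD)
  have ih: "i \<in> hom_set C d a" and qh: "q \<in> hom_set C a d" and jh: "j \<in> hom_set C b c"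
    using i j Inc_subset q by (auto simp: hom_set_def a_def b_def c_def d_def)
  have uh: "u \<in> hom_set C d b"
    using u uj qu qh unfolding isomorphism_def by (auto simp: hom_set_def b_def)
  have quh: "q \<cdot> u \<in> hom_set C a b"
    using qh uh by (rule Comp_in_hom)
  have vi: "v \<cdot> i \<in> hom_set C b a"
    using v ih by (rule Comp_in_hom)
  have "(v \<cdot> i) \<cdot> (q \<cdot> u) = v \<cdot> (i \<cdot> (q \<cdot> u))"
    using v ih quh by (rule Comp_assoc)
  also have "i \<cdot> (q \<cdot> u) = (i \<cdot> q) \<cdot> u"
    using Comp_assoc[OF ih qh uh] by simp
  also have "\<dots> = u"
    using iq Id_Comp[OF uh] by (simp add: d_def)
  finally have "(v \<cdot> i) \<cdot> (q \<cdot> u) = Id C b"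
    using vu by simp
  moreover have "f \<in> hom_set C a c"
    unfolding f using quh jh by (rule Comp_in_hom)
  ultimately show thesis
    using that[OF _ quh jh j f vi] by blast
qed

text \<open>Multiplying \<open>e \<cdot> j = e' \<cdot> j'\<close> on the left by \<open>s\<close>
  gives \<open>j = (s \<cdot> e') \<cdot> j'\<close>, and an arrow through which one inclusion
  factors over another is itself an inclusion (\<open>Inc_factor\<close>).\<close>

lemma (in category_with_subobjects) epi_inclusion_factor:
  assumes "e \<in> hom_set C a b" "j \<in> hom_set C b c" "s \<in> hom_set C b a" "s \<cdot> e = Id C b"
    and "e' \<in> hom_set C a b'" "j' \<in> hom_set C b' c" "e \<cdot> j = e' \<cdot> j'"
    and "j \<in> Inc C" "j' \<in> Inc C"
  shows "s \<cdot> e' \<in> Inc C \<inter> hom_set C b b'" "j = (s \<cdot> e') \<cdot> j'"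
proof -
  have "j = (s \<cdot> e) \<cdot> j"
    using assms(4) Id_Comp[OF assms(2)] by simp
  also have "\<dots> = s \<cdot> (e' \<cdot> j')"
    using Comp_assoc[OF assms(3,1,2)] assms(7) by simp
  also have "\<dots> = (s \<cdot> e') \<cdot> j'"
    using Comp_assoc[OF assms(3,5,6)] by simp
  finally show j: "j = (s \<cdot> e') \<cdot> j'" .
  have h: "s \<cdot> e' \<in> hom_set C b b'"
    using assms(3,5) by (rule Comp_in_hom)
  show "s \<cdot> e' \<in> Inc C \<inter> hom_set C b b'"
    using Inc_factor[OF assms(8,9) hom_setD(1)[OF h] _ j] h assms(6) by (auto simp: hom_set_def)
qed

text \<open>Two factorisations yield inclusions in both directions between their middle objects. By
  antisymmetry these objects coincide and \<open>s \<cdot> e\<close> is the identity, so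
  \<open>j = j'\<close>; this monomorphism is then cancelled.\<close>

lemma (in category_with_subobjects) epi_part_eqI:
  assumes "normal_factorisation C f q u j"
  shows "epi_part C f = q \<cdot> u"
  unfolding epi_part_def
proof (rule the_equality)
  fix e assume "\<exists>q u j. normal_factorisation C f q u j \<and> e = q \<cdot> u"
  then obtain q' u' j' where nf': "normal_factorisation C f q' u' j'" and e: "e = q' \<cdot> u'"
    by blast
  obtain a b c s where f: "f \<in> hom_set C a c" "f = (q \<cdot> u) \<cdot> j"
    and F: "q \<cdot> u \<in> hom_set C a b" "j \<in> hom_set C b c" "j \<in> Inc C" "s \<in> hom_set C b a"
      "s \<cdot> (q \<cdot> u) = Id C b"
    using normal_factorisation_split_epi[OF assms] by metis
  obtain a' b' c' s' where f': "f \<in> hom_set C a' c'" "f = e \<cdot> j'"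
    and F': "e \<in> hom_set C a' b'" "j' \<in> hom_set C b' c'" "j' \<in> Inc C" "s' \<in> hom_set C b' a'"
      "s' \<cdot> e = Id C b'"
    using normal_factorisation_split_epi[OF nf'] e by metis
  have [simp]: "a' = a" "c' = c"
    using f f' by (auto simp: hom_set_def)
  have eq: "(q \<cdot> u) \<cdot> j = e \<cdot> j'"
    using f f' by simp
  note F' = F'[simplified]
  note 1 = epi_inclusion_factor[OF F(1,2,4,5) F'(1,2) eq F(3) F'(3)]
  note 2 = epi_inclusion_factor[OF F'(1,2,4,5) F(1,2) eq[symmetric] F'(3) F(3)]
  from 1(1) 2(1) have "b' = b" "s \<cdot> e = Id C b"
    using Inc_antisym[of "s \<cdot> e" b b' "s' \<cdot> (q \<cdot> u)"] by auto
  then have "j = j'"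
    using 1(2) Id_Comp F'(2) by simp
  then show "e = q \<cdot> u"
    using Inc_cancel[OF F(3,2) F(1)] F'(1) eq \<open>b' = b\<close> by simp
qed (use assms in blast)

text \<open>Reduces \<open>f\<^sup>\<circ>\<close> to what calculations with cones use: where it
  starts, and that an inclusion carries it to \<open>f\<close>.\<close>

lemma (in normal_category) epi_part_factor:
  assumes "f \<in> hom_set C a c"
  obtains b j where "epi_part C f \<in> hom_set C a b" "j \<in> hom_set C b c"
    "j \<in> Inc C" "f = epi_part C f \<cdot> j"
proof -
  obtain q u j where nf: "normal_factorisation C f q u j"
    using ex_normal_factorisation[OF hom_setD(1)[OF assms]] by blast
  from normal_factorisation_split_epi[OF nf] obtain a' b c'
    where "f \<in> hom_set C a' c'" "q \<cdot> u \<in> hom_set C a' b" "j \<in> hom_set C b c'"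
      "j \<in> Inc C" "f = (q \<cdot> u) \<cdot> j" .
  then show thesis
    using that assms unfolding epi_part_eqI[OF nf] by (auto simp: hom_set_def)
qed

section \<open>Cones, vertices and idempotent cones\<close>

lemma coneD:
  assumes "cone C z \<gamma>"
  shows "z \<in> Obj C" "\<gamma> \<in> extensional (Obj C)" "c \<in> Obj C \<Longrightarrow> \<gamma> c \<in> hom_set C c z"
    "\<lbrakk>a \<in> Obj C; b \<in> Obj C; subobject C a b\<rbrakk> \<Longrightarrow> inclusion C a b \<cdot>\<^bsub>C\<^esub> \<gamma> b = \<gamma> a"
    "\<exists>c\<in>Obj C. isomorphism C (\<gamma> c)"
  using assms unfolding cone_def by auto

text \<open>The vertex is the codomain of every component, and \<open>z\<close> is itself an object
  at which a component can be inspected.\<close>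

lemma vertex_eqI:
  assumes "cone C z \<gamma>"
  shows "vertex C \<gamma> = z"
  unfolding vertex_def
proof (rule the_equality)
  fix z' assume "cone C z' \<gamma>"
  then show "z' = z"
    using coneD(3)[OF assms coneD(1)[OF assms]] coneD(3)[OF _ coneD(1)[OF assms]]
    by (auto simp: hom_set_def)
qed fact

lemma cone_sgrp_Elems: "\<gamma> \<in> Elems (cone_sgrp C) \<longleftrightarrow> cone C (vertex C \<gamma>) \<gamma>"
  unfolding cone_sgrp_def using vertex_eqI by fastforce

lemma cone_sgrp_Mult:
  "Mult (cone_sgrp C) \<gamma> \<delta> = cone_star C \<gamma> (epi_part C (\<delta> (vertex C \<gamma>)))"
  by (simp add: cone_sgrp_def)

text \<open>Idempotency says that right multiplication by \<open>epi_part C (\<gamma> c)\<close>,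
  with \<open>c\<close> the vertex, fixes every component. Comparing codomains shows that this
  epimorphism is \<open>\<gamma> c\<close> itself; a component \<open>\<gamma> x\<close> that is an
  isomorphism can then be cancelled from
  \<open>\<gamma> x \<cdot> \<gamma> c = \<gamma> x\<close>.\<close>

lemma (in normal_category) idempotent_cone_at_vertex:
  assumes "\<gamma> \<in> idempotents (cone_sgrp C)"
  shows "\<gamma> (vertex C \<gamma>) = Id C (vertex C \<gamma>)"
proof -
  define c where "c = vertex C \<gamma>"
  have \<gamma>: "cone C c \<gamma>" and idem: "cone_star C \<gamma> (epi_part C (\<gamma> c)) = \<gamma>"
    using assms unfolding idempotents_def by (auto simp: cone_sgrp_Elems c_def cone_sgrp_Mult)
  note c = coneD(1)[OF \<gamma>]
  obtain b j where e: "epi_part C (\<gamma> c) \<in> hom_set C c b" and j: "j \<in> hom_set C b c" "j \<in> Inc C"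
    and ej: "\<gamma> c = epi_part C (\<gamma> c) \<cdot> j"
    using epi_part_factor[OF coneD(3)[OF \<gamma> c]] by metis
  have star: "\<gamma> x \<cdot> epi_part C (\<gamma> c) = \<gamma> x" if "x \<in> Obj C" for x
    using fun_cong[OF idem, of x] that by (simp add: cone_star_def)
  \<comment> \<open>The product of \<open>\<gamma> c\<close> with the epimorphism ends at
    \<open>b\<close>, but by idempotency it is \<open>\<gamma> c\<close>, which ends at
    \<open>c\<close>. Hence \<open>j\<close> includes \<open>c\<close> into itself and is the
    identity.\<close>
  have "\<gamma> c \<in> hom_set C c b"
    using Comp_in_hom[OF coneD(3)[OF \<gamma> c] e] star[OF c] by simp
  then have [simp]: "b = c"
    using coneD(3)[OF \<gamma> c] by (simp add: hom_set_def)
  have "j = Id C c"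
    using j by (simp add: Inc_endo)
  then have e_eq: "epi_part C (\<gamma> c) = \<gamma> c"
    using ej e Comp_Id by simp
  obtain x where x: "x \<in> Obj C" "isomorphism C (\<gamma> x)"
    using coneD(5)[OF \<gamma>] by blast
  note \<gamma>x = coneD(3)[OF \<gamma> x(1)]
  obtain g where g: "g \<in> hom_set C c x" "g \<cdot> \<gamma> x = Id C c"
    using x \<gamma>x unfolding isomorphism_def by (auto simp: hom_set_def)
  have "\<gamma> c = (g \<cdot> \<gamma> x) \<cdot> \<gamma> c"
    using g Id_Comp[OF coneD(3)[OF \<gamma> c]] by simp
  also have "\<dots> = g \<cdot> (\<gamma> x \<cdot> \<gamma> c)"
    using g(1) \<gamma>x coneD(3)[OF \<gamma> c] by (rule Comp_assoc)
  also have "\<dots> = Id C c"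
    using star[OF x(1)] e_eq g by simp
  finally show ?thesis
    by (simp add: c_def)
qed

lemma (in normal_category) idempotent_cone_unique:
  assumes "idempotent_cone_in C c d \<gamma>" "idempotent_cone_in C c d \<delta>" "d \<in> cone_classes C"
  shows "\<gamma> = \<delta>"
proof -
  from assms have "\<gamma> \<in> idempotents (cone_sgrp C)" "\<delta> \<in> idempotents (cone_sgrp C)"
    and v: "vertex C \<gamma> = c" "vertex C \<delta> = c" and d: "\<gamma> \<in> d" "\<delta> \<in> d"
    unfolding idempotent_cone_in_def by auto
  then have Id: "\<gamma> c = Id C c" "\<delta> c = Id C c"
    using idempotent_cone_at_vertex by metis+
  have \<gamma>: "cone C c \<gamma>" and \<delta>: "cone C c \<delta>"
    using assms by (auto simp: idempotent_cone_in_def idempotents_def cone_sgrp_Elems)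
  have "right_ideal (cone_sgrp C) \<gamma> = right_ideal (cone_sgrp C) \<delta>"
    using assms(3) d unfolding R_classes_def quotient_def green_R_def by auto
  then have "\<gamma> \<in> right_ideal (cone_sgrp C) \<delta>"
    unfolding right_ideal_def by blast
  \<comment> \<open>The right ideal is formed with its generator adjoined, whence the first case. In
    the second, the product with \<open>\<xi>\<close> involves only the component of
    \<open>\<xi>\<close> at the common vertex \<open>c\<close>.\<close>
  then consider "\<gamma> = \<delta>" | \<xi> where "\<xi> \<in> Elems (cone_sgrp C)" "\<gamma> = Mult (cone_sgrp C) \<delta> \<xi>"
    unfolding right_ideal_def by blast
  then show ?thesis
  proof cases
    case 2
    define e where "e = epi_part C (\<xi> c)"
    note c = coneD(1)[OF \<delta>]
    have "cone C (vertex C \<xi>) \<xi>"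
      using 2 by (simp add: cone_sgrp_Elems)
    from epi_part_factor[OF coneD(3)[OF this c]] obtain b where e: "e \<in> hom_set C c b"
      unfolding e_def by metis
    have star: "\<gamma> x = \<delta> x \<cdot> e" if "x \<in> Obj C" for x
      using 2 v that unfolding e_def by (simp add: cone_sgrp_Mult cone_star_def)
    have "e = Id C c"
      using star[OF c] Id_Comp[OF e] Id by simp
    then have "\<gamma> x = \<delta> x" if "x \<in> Obj C" for x
      using star[OF that] Comp_Id[OF coneD(3)[OF \<delta> that]] by simp
    then show ?thesis
      using coneD(2)[OF \<gamma>] coneD(2)[OF \<delta>] by (rule extensionalityI[rotated 2])
  qed
qed

lemma (in normal_category) idem_cone_eqI:
  assumes "idempotent_cone_in C c d \<gamma>" "d \<in> cone_classes C"
  shows "idem_cone C c d = \<gamma>"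
  unfolding idem_cone_def using assms idempotent_cone_unique by (blast intro: the_equality)

section \<open>Transport along isomorphisms of categories\<close>

text \<open>Inverse bijections on objects and arrows, with inclusions preserved both ways. Beyond
  this only the category axioms and \<open>Inc \<subseteq> Arr\<close> are assumed, because the
  subobject axioms for \<open>C'\<close> are to be derived from those for \<open>C\<close>.\<close>

locale category_iso =
  C: category C + C': category C' +
  F: inclusion_preserving_functor C C' Fo Fa + F': inclusion_preserving_functor C' C Fo' Fa'
  for C :: "('o, 'm) cat" and C' :: "('p, 'k) cat" and Fo Fa Fo' Fa' +
  assumes Inc_Arr: "Inc C \<subseteq> Arr C" and Inc_Arr': "Inc C' \<subseteq> Arr C'"
    and Fo'_Fo: "c \<in> Obj C \<Longrightarrow> Fo' (Fo c) = c" and Fo_Fo': "c' \<in> Obj C' \<Longrightarrow> Fo (Fo' c') = c'"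
    and Fa'_Fa: "f \<in> Arr C \<Longrightarrow> Fa' (Fa f) = f" and Fa_Fa': "f' \<in> Arr C' \<Longrightarrow> Fa (Fa' f') = f'"
begin

text \<open>The symmetry through which the results of this locale also apply to the inverse
  functor.\<close>

lemma converse: "category_iso C' C Fo' Fa' Fo Fa"
  by unfold_locales (use Inc_Arr Inc_Arr' Fo'_Fo Fo_Fo' Fa'_Fa Fa_Fa' in auto)

lemma Fa_Arr:
  assumes "f \<in> Arr C"
  shows "Fa f \<in> Arr C'" "Dom C' (Fa f) = Fo (Dom C f)" "Cod C' (Fa f) = Fo (Cod C f)"
  using F.F_hom[OF Arr_in_hom[OF assms]] by (auto simp: hom_set_def)

lemma isomorphism_Fa:
  assumes "isomorphism C f"
  shows "isomorphism C' (Fa f)"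
proof -
  from assms obtain g where f: "f \<in> hom_set C (Dom C f) (Cod C f)"
    and g: "g \<in> hom_set C (Cod C f) (Dom C f)"
    and fg: "f \<cdot>\<^bsub>C\<^esub> g = Id C (Dom C f)" "g \<cdot>\<^bsub>C\<^esub> f = Id C (Cod C f)"
    unfolding isomorphism_def by (auto intro: Arr_in_hom)
  note o = C.hom_Obj[OF f]
  have "Fa f \<cdot>\<^bsub>C'\<^esub> Fa g = Id C' (Fo (Dom C f))" "Fa g \<cdot>\<^bsub>C'\<^esub> Fa f = Id C' (Fo (Cod C f))"
    using F.F_Comp[OF f g] F.F_Comp[OF g f] fg o by (simp_all add: F.F_Id)
  then show ?thesis
    unfolding isomorphism_def using F.F_hom[OF g] Fa_Arr[OF hom_setD(1)[OF f]] by auto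
qed

text \<open>Two arrows identified by \<open>Fa f\<close> are carried by \<open>Fa'\<close> to arrows
  identified by \<open>f\<close>, and \<open>Fa'\<close> is injective on arrows.\<close>

lemma monomorphism_Fa:
  assumes "monomorphism C f"
  shows "monomorphism C' (Fa f)"
proof -
  from assms have f: "f \<in> Arr C"
    unfolding monomorphism_def by blast
  note fh = Arr_in_hom[OF f]
  have "g = h" if g: "g \<in> hom_set C' a (Fo (Dom C f))" and h: "h \<in> hom_set C' a (Fo (Dom C f))"
    and eq: "g \<cdot>\<^bsub>C'\<^esub> Fa f = h \<cdot>\<^bsub>C'\<^esub> Fa f" for a g h
  proof -
    have *: "Fa' k \<in> hom_set C (Fo' a) (Dom C f)" "Fa' (k \<cdot>\<^bsub>C'\<^esub> Fa f) = Fa' k \<cdot>\<^bsub>C\<^esub> f"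
      if k: "k \<in> hom_set C' a (Fo (Dom C f))" for k
      using F'.F_hom[OF k] F'.F_Comp[OF k F.F_hom[OF fh]] C.Dom_in_Obj[OF f] f
      by (simp_all add: Fo'_Fo Fa'_Fa)
    have "Fa' g = Fa' h"
      using assms *[OF g] *[OF h] eq unfolding monomorphism_def by metis
    then show ?thesis
      using g h Fa_Fa' by (metis hom_setD(1))
  qed
  then show ?thesis
    unfolding monomorphism_def using Fa_Arr[OF f] by simp
qed

lemma retraction_of_Fa:
  assumes "retraction_of C j q"
  shows "retraction_of C' (Fa j) (Fa q)"
proof -
  from assms have j: "j \<in> Inc C" and q: "q \<in> hom_set C (Cod C j) (Dom C j)"
    and jq: "j \<cdot>\<^bsub>C\<^esub> q = Id C (Dom C j)"
    unfolding retraction_of_def by auto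
  then have ja: "j \<in> Arr C"
    using Inc_Arr by blast
  show ?thesis
    unfolding retraction_of_def
    using F.F_Inc[OF j] F.F_hom[OF q] F.F_Comp[OF Arr_in_hom[OF ja] q] jq Fa_Arr[OF ja]
      C.Dom_in_Obj[OF ja] by (simp add: F.F_Id)
qed

lemma normal_factorisation_Fa:
  assumes "normal_factorisation C f q u j"
  shows "normal_factorisation C' (Fa f) (Fa q) (Fa u) (Fa j)" "Fa (q \<cdot>\<^bsub>C\<^esub> u) = Fa q \<cdot>\<^bsub>C'\<^esub> Fa u"
proof -
  from assms have q: "retraction C q" and u: "isomorphism C u" and j: "j \<in> Inc C"
    and qu: "Cod C q = Dom C u" and uj: "Cod C u = Dom C j" and f: "f = (q \<cdot>\<^bsub>C\<^esub> u) \<cdot>\<^bsub>C\<^esub> j"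
    unfolding normal_factorisation_def by auto
  have arr: "q \<in> Arr C" "u \<in> Arr C" "j \<in> Arr C"
    using q u j Inc_Arr unfolding retraction_def retraction_of_def isomorphism_def
    by (auto dest: hom_setD)
  have qh: "q \<in> hom_set C (Dom C q) (Dom C u)" and uh: "u \<in> hom_set C (Dom C u) (Dom C j)"
    and jh: "j \<in> hom_set C (Dom C j) (Cod C j)"
    using arr qu uj by (auto simp: hom_set_def)
  show qu': "Fa (q \<cdot>\<^bsub>C\<^esub> u) = Fa q \<cdot>\<^bsub>C'\<^esub> Fa u"
    using qh uh by (rule F.F_Comp)
  have "Fa f = (Fa q \<cdot>\<^bsub>C'\<^esub> Fa u) \<cdot>\<^bsub>C'\<^esub> Fa j"
    unfolding f qu'[symmetric] using C.Comp_in_hom[OF qh uh] jh by (rule F.F_Comp)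
  moreover have "retraction C' (Fa q)"
    using q retraction_of_Fa unfolding retraction_def by blast
  ultimately show "normal_factorisation C' (Fa f) (Fa q) (Fa u) (Fa j)"
    unfolding normal_factorisation_def
    using isomorphism_Fa[OF u] F.F_Inc[OF j] Fa_Arr arr qu uj by simp
qed

lemma subobject_Fo:
  assumes "subobject C a b"
  shows "subobject C' (Fo a) (Fo b)"
  using assms F.F_hom F.F_Inc unfolding subobject_def by blast

text \<open>Each axiom is used in \<open>C\<close> for the images under \<open>Fa'\<close>. Its
  conclusion returns to \<open>C'\<close> because \<open>Fa'\<close> is injective on arrows and
  reflects inclusions, and because \<open>Fa\<close> preserves monomorphisms.\<close>

lemma category_with_subobjects_transport:
  assumes "category_with_subobjects C"
  shows "category_with_subobjects C'"
proof -
  interpret C: category_with_subobjects C by fact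
  interpret inv: category_iso C' C Fo' Fa' Fo Fa by (rule converse)
  have inj: "f = g" if "Fa' f = Fa' g" "f \<in> Arr C'" "g \<in> Arr C'" for f g
    using that Fa_Fa' by metis
  have comp: "Fa' (f \<cdot>\<^bsub>C'\<^esub> g) = Fa' f \<cdot>\<^bsub>C\<^esub> Fa' g" "f \<cdot>\<^bsub>C'\<^esub> g \<in> Arr C'"
    if "f \<in> Arr C'" "g \<in> Arr C'" "Cod C' f = Dom C' g" for f g
  proof -
    have "f \<in> hom_set C' (Dom C' f) (Dom C' g)" "g \<in> hom_set C' (Dom C' g) (Cod C' g)"
      using that by (auto simp: hom_set_def)
    then show "Fa' (f \<cdot>\<^bsub>C'\<^esub> g) = Fa' f \<cdot>\<^bsub>C\<^esub> Fa' g" "f \<cdot>\<^bsub>C'\<^esub> g \<in> Arr C'"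
      using F'.F_Comp C'.Comp_in_hom[THEN hom_setD(1)] by blast+
  qed
  have IncI: "f \<in> Inc C'" if "Fa' f \<in> Inc C" "f \<in> Arr C'" for f
    using F.F_Inc[OF that(1)] that(2) by (simp add: Fa_Fa')
  show ?thesis
  proof
    show "Inc C' \<subseteq> Arr C'" by (rule Inc_Arr')
  next
    fix c assume "c \<in> Obj C'"
    then show "Id C' c \<in> Inc C'"
      using IncI C.Id_in_Inc F'.F_Obj F'.F_Id C'.Id_in_hom hom_setD(1) by metis
  next
    fix f g assume *: "f \<in> Inc C'" "g \<in> Inc C'" "Cod C' f = Dom C' g"
    then have "f \<in> Arr C'" "g \<in> Arr C'"
      using Inc_Arr' by auto
    then show "f \<cdot>\<^bsub>C'\<^esub> g \<in> Inc C'"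
      using * IncI comp C.Comp_in_Inc F'.F_Inc by (simp add: inv.Fa_Arr)
  next
    fix f g assume *: "f \<in> Inc C'" "g \<in> Inc C'" "Dom C' f = Dom C' g" "Cod C' f = Cod C' g"
    then have arr: "f \<in> Arr C'" "g \<in> Arr C'"
      using Inc_Arr' by auto
    then have "Fa' f = Fa' g"
      using * F'.F_Inc by (auto intro: C.Inc_unique simp: inv.Fa_Arr)
    then show "f = g"
      using arr by (rule inj)
  next
    fix f g assume fg: "f \<in> Inc C'" "g \<in> Inc C'" "Dom C' g = Cod C' f" "Cod C' g = Dom C' f"
      "f \<cdot>\<^bsub>C'\<^esub> g = Id C' (Dom C' f)" "g \<cdot>\<^bsub>C'\<^esub> f = Id C' (Cod C' f)"
    then have arr: "f \<in> Arr C'" "g \<in> Arr C'"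
      using Inc_Arr' by auto
    have "Fa' f = Id C (Dom C (Fa' f))"
      using C.Inc_iso[of "Fa' f" "Fa' g"] fg arr comp(1)[of f g] comp(1)[of g f]
      by (simp add: F'.F_Inc inv.Fa_Arr F'.F_Id C'.Dom_in_Obj C'.Cod_in_Obj)
    then have "Fa' f = Fa' (Id C' (Dom C' f))"
      using arr by (simp add: inv.Fa_Arr F'.F_Id C'.Dom_in_Obj)
    then show "f = Id C' (Dom C' f)"
      using arr(1) C'.Id_in_hom[OF C'.Dom_in_Obj[OF arr(1)], THEN hom_setD(1)] by (rule inj)
  next
    fix f assume f: "f \<in> Inc C'"
    then show "monomorphism C' f"
      using monomorphism_Fa[OF C.Inc_mono[OF F'.F_Inc[OF f]]] Fa_Fa' Inc_Arr' by auto
  next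
    fix f g h assume *: "f \<in> Inc C'" "g \<in> Inc C'" "h \<in> Arr C'" "Cod C' h = Dom C' g"
      "f = h \<cdot>\<^bsub>C'\<^esub> g"
    then have g: "g \<in> Arr C'"
      using Inc_Arr' by auto
    have "Fa' f = Fa' h \<cdot>\<^bsub>C\<^esub> Fa' g"
      using comp(1)[OF *(3) g *(4)] *(5) by simp
    then have "Fa' h \<in> Inc C"
      using C.Inc_factor[OF F'.F_Inc[OF *(1)] F'.F_Inc[OF *(2)]] *(3,4) g by (simp add: inv.Fa_Arr)
    then show "h \<in> Inc C'"
      using *(3) by (rule IncI)
  qed
qed

end

section \<open>Transport of cones\<close>

definition push_cone ::
    "('p, 'k) cat \<Rightarrow> ('m \<Rightarrow> 'k) \<Rightarrow> ('p \<Rightarrow> 'o) \<Rightarrow> ('o \<Rightarrow> 'm) \<Rightarrow> ('p \<Rightarrow> 'k)" where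
  "push_cone C' Fa Fo' \<gamma> = (\<lambda>c\<in>Obj C'. Fa (\<gamma> (Fo' c)))"

text \<open>Since \<open>inclusion\<close> is a definite description, compatibility of cones with
  inclusions is transported only once inclusions are known to be unique in both categories.\<close>

locale subobject_category_iso =
  category_iso C C' Fo Fa Fo' Fa' + C: category_with_subobjects C + C': category_with_subobjects C'
  for C :: "('o, 'm) cat" and C' :: "('p, 'k) cat" and Fo Fa Fo' Fa'
begin

abbreviation push :: "('o \<Rightarrow> 'm) \<Rightarrow> 'p \<Rightarrow> 'k" where
  "push \<equiv> push_cone C' Fa Fo'"

abbreviation pull :: "('p \<Rightarrow> 'k) \<Rightarrow> 'o \<Rightarrow> 'm" where
  "pull \<equiv> push_cone C Fa' Fo"

lemma converse: "subobject_category_iso C' C Fo' Fa' Fo Fa"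
  using C.category_with_subobjects_axioms C'.category_with_subobjects_axioms
    category_iso.converse[OF category_iso_axioms]
  by (simp add: subobject_category_iso_def)

text \<open>The image of an inclusion is an inclusion with the required ends, and there is only one
  such.\<close>

lemma Fa_inclusion:
  assumes "subobject C a b"
  shows "inclusion C' (Fo a) (Fo b) = Fa (inclusion C a b)"
  using C.inclusion_in[OF assms] F.F_hom F.F_Inc by (blast intro: C'.inclusion_eqI)

lemma cone_push:
  assumes "cone C z \<gamma>"
  shows "cone C' (Fo z) (push \<gamma>)"
  unfolding cone_def
proof (intro conjI ballI impI)
  interpret inv: subobject_category_iso C' C Fo' Fa' Fo Fa by (rule converse)
  have hom: "Fa (\<gamma> (Fo' c)) \<in> hom_set C' c (Fo z)" if "c \<in> Obj C'" for c
    using F.F_hom[OF coneD(3)[OF assms F'.F_Obj[OF that]]] that by (simp add: Fo_Fo')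
  show "Fo z \<in> Obj C'"
    using coneD(1)[OF assms] by (rule F.F_Obj)
  show "push \<gamma> \<in> extensional (Obj C')"
    by (simp add: push_cone_def)
  show "push \<gamma> c \<in> hom_set C' c (Fo z)" if "c \<in> Obj C'" for c
    using hom that by (simp add: push_cone_def)
  show "inclusion C' a b \<cdot>\<^bsub>C'\<^esub> push \<gamma> b = push \<gamma> a"
    if ab: "a \<in> Obj C'" "b \<in> Obj C'" "subobject C' a b" for a b
  proof -
    note ab' = F'.F_Obj[OF ab(1)] F'.F_Obj[OF ab(2)]
    have sub: "subobject C (Fo' a) (Fo' b)"
      using ab(3) by (rule inv.subobject_Fo)
    then have "inclusion C' a b = Fa (inclusion C (Fo' a) (Fo' b))"
      using Fa_inclusion[OF sub] ab by (simp add: Fo_Fo')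
    then show ?thesis
      using F.F_Comp[OF C.inclusion_in(1)[OF sub] coneD(3)[OF assms ab'(2)]]
        coneD(4)[OF assms ab' sub] ab by (simp add: push_cone_def)
  qed
  obtain c where c: "c \<in> Obj C" "isomorphism C (\<gamma> c)"
    using coneD(5)[OF assms] by blast
  show "\<exists>c\<in>Obj C'. isomorphism C' (push \<gamma> c)"
    by (rule bexI[of _ "Fo c"])
      (use c F.F_Obj isomorphism_Fa in \<open>auto simp: push_cone_def Fo'_Fo\<close>)
qed

text \<open>Cones are extensional, so agreement at the objects is already equality of functions.
  This is what makes the maps on cones, and later on classes of cones, strictly inverse.\<close>

lemma pull_push:
  assumes "cone C z \<gamma>"
  shows "pull (push \<gamma>) = \<gamma>"
proof (rule extensionalityI)
  fix c assume "c \<in> Obj C"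
  then show "pull (push \<gamma>) c = \<gamma> c"
    using coneD(3)[OF assms, THEN hom_setD(1)] by (simp add: push_cone_def F.F_Obj Fo'_Fo Fa'_Fa)
qed (use coneD(2)[OF assms] in \<open>auto simp: push_cone_def\<close>)

lemma vertex_push: "cone C z \<gamma> \<Longrightarrow> vertex C' (push \<gamma>) = Fo z"
  by (intro vertex_eqI cone_push)

lemma push_cone_star:
  assumes "cone C z \<gamma>" "f \<in> hom_set C z w"
  shows "push (cone_star C \<gamma> f) = cone_star C' (push \<gamma>) (Fa f)"
proof (rule extensionalityI)
  fix c assume c: "c \<in> Obj C'"
  then show "push (cone_star C \<gamma> f) c = cone_star C' (push \<gamma>) (Fa f) c"
    using F.F_Comp[OF coneD(3)[OF assms(1) F'.F_Obj[OF c]] assms(2)]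
    by (simp add: push_cone_def cone_star_def F'.F_Obj)
qed (auto simp: push_cone_def cone_star_def)

lemma push_Elems: "\<gamma> \<in> Elems (cone_sgrp C) \<Longrightarrow> push \<gamma> \<in> Elems (cone_sgrp C')"
  unfolding cone_sgrp_Elems by (metis cone_push vertex_push)

lemma pull_push_Elems: "\<gamma> \<in> Elems (cone_sgrp C) \<Longrightarrow> pull (push \<gamma>) = \<gamma>"
  unfolding cone_sgrp_Elems by (rule pull_push)

end

section \<open>Transport of normality\<close>

lemma (in category_iso) subobject_category_iso:
  "category_with_subobjects C \<Longrightarrow> subobject_category_iso C C' Fo Fa Fo' Fa'"
  using category_iso_axioms category_with_subobjects_transport
  by (simp add: subobject_category_iso_def)

text \<open>Inclusions, arrows and objects of \<open>C'\<close> are images of those of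
  \<open>C\<close>, and the functor carries retractions, normal factorisations and cones
  along.\<close>

lemma (in category_iso) normal_category_transport:
  assumes "normal_category C"
  shows "normal_category C'"
proof -
  interpret C: normal_category C by fact
  interpret subobject_category_iso C C' Fo Fa Fo' Fa'
    using C.category_with_subobjects_axioms by (rule subobject_category_iso)
  show ?thesis
  proof
    fix j assume j: "j \<in> Inc C'"
    then obtain q where "retraction_of C (Fa' j) q"
      using C.Inc_splits[OF F'.F_Inc] unfolding splits_def by blast
    moreover have "Fa (Fa' j) = j"
      using j Inc_Arr' by (blast intro: Fa_Fa')
    ultimately show "splits C' j"
      using retraction_of_Fa[of "Fa' j" q] unfolding splits_def by auto
  next
    interpret inv: subobject_category_iso C' C Fo' Fa' Fo Fa
      by (rule converse)
    fix f assume f: "f \<in> Arr C'"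
    then obtain q u j where "normal_factorisation C (Fa' f) q u j"
      using C.ex_normal_factorisation[OF inv.Fa_Arr(1)[OF f]] by blast
    then show "\<exists>q u j. normal_factorisation C' f q u j"
      using normal_factorisation_Fa(1)[of "Fa' f" q u j] Fa_Fa'[OF f] by auto
  next
    fix c assume c: "c \<in> Obj C'"
    then obtain \<mu> where \<mu>: "cone C (Fo' c) \<mu>" "\<mu> (Fo' c) = Id C (Fo' c)"
      using C.ex_cone F'.F_Obj by blast
    then show "\<exists>\<mu>. cone C' c \<mu> \<and> \<mu> c = Id C' c"
      using cone_push[OF \<mu>(1)] c
      by (intro exI[of _ "push \<mu>"]) (simp add: push_cone_def Fo_Fo' F.F_Id F'.F_Obj)
  qed
qed

section \<open>The semigroup of cones, Green's relation R and CC-morphisms\<close>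

locale normal_category_iso =
  subobject_category_iso C C' Fo Fa Fo' Fa' + C: normal_category C + C': normal_category C'
  for C :: "('o, 'm) cat" and C' :: "('p, 'k) cat" and Fo Fa Fo' Fa'
begin

lemma converse: "normal_category_iso C' C Fo' Fa' Fo Fa"
  using C.normal_category_axioms C'.normal_category_axioms
    subobject_category_iso.converse[OF subobject_category_iso_axioms]
  by (simp add: normal_category_iso_def)

text \<open>Normal factorisations go to normal factorisations, and uniqueness of the epimorphism on
  both sides makes the two definite descriptions agree.\<close>

lemma epi_part_Fa:
  assumes "f \<in> Arr C"
  shows "epi_part C' (Fa f) = Fa (epi_part C f)"
proof -
  obtain q u j where "normal_factorisation C f q u j"
    using C.ex_normal_factorisation[OF assms] by blast
  from normal_factorisation_Fa[OF this] this show ?thesis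
    by (simp add: C.epi_part_eqI C'.epi_part_eqI)
qed

text \<open>The product depends on \<open>\<delta>\<close> only through its component at the vertex
  of \<open>\<gamma>\<close>; vertices, components and \<open>f\<^sup>\<circ>\<close> are all
  transported. Being also bijective, \<open>push\<close> is an isomorphism of semigroups, and so
  carries idempotents, right ideals and R-classes along.\<close>

lemma push_Mult:
  assumes "\<gamma> \<in> Elems (cone_sgrp C)" "\<delta> \<in> Elems (cone_sgrp C)"
  shows "push (Mult (cone_sgrp C) \<gamma> \<delta>) = Mult (cone_sgrp C') (push \<gamma>) (push \<delta>)"
proof -
  define z where "z = vertex C \<gamma>"
  have \<gamma>: "cone C z \<gamma>" and \<delta>: "cone C (vertex C \<delta>) \<delta>"
    using assms by (auto simp: cone_sgrp_Elems z_def)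
  note z = coneD(1)[OF \<gamma>]
  have \<delta>z: "\<delta> z \<in> hom_set C z (vertex C \<delta>)"
    using \<delta> z by (rule coneD(3))
  obtain b where e: "epi_part C (\<delta> z) \<in> hom_set C z b"
    using C.epi_part_factor[OF \<delta>z] by metis
  have "Mult (cone_sgrp C') (push \<gamma>) (push \<delta>)
      = cone_star C' (push \<gamma>) (epi_part C' (push \<delta> (Fo z)))"
    by (simp add: cone_sgrp_Mult vertex_push[OF \<gamma>])
  also have "push \<delta> (Fo z) = Fa (\<delta> z)"
    using z by (simp add: push_cone_def F.F_Obj Fo'_Fo)
  also have "epi_part C' (Fa (\<delta> z)) = Fa (epi_part C (\<delta> z))"
    using \<delta>z by (intro epi_part_Fa) (rule hom_setD)
  finally show ?thesis
    using push_cone_star[OF \<gamma> e] by (simp add: cone_sgrp_Mult z_def)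
qed

lemma push_idempotents:
  "\<gamma> \<in> idempotents (cone_sgrp C) \<Longrightarrow> push \<gamma> \<in> idempotents (cone_sgrp C')"
  unfolding idempotents_def using push_Elems push_Mult[of \<gamma> \<gamma>] by simp

lemma push_Elems_surj: "push ` Elems (cone_sgrp C) = Elems (cone_sgrp C')"
proof -
  interpret inv: normal_category_iso C' C Fo' Fa' Fo Fa by (rule converse)
  have "\<gamma> \<in> push ` Elems (cone_sgrp C)" if "\<gamma> \<in> Elems (cone_sgrp C')" for \<gamma>
    using inv.pull_push_Elems[OF that] inv.push_Elems[OF that] by (rule image_eqI[OF sym])
  then show ?thesis
    using push_Elems by blast
qed

text \<open>Surjectivity of \<open>push\<close> on cones gives an equality here rather than a
  containment.\<close>

lemma right_ideal_push:
  assumes "\<gamma> \<in> Elems (cone_sgrp C)"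
  shows "right_ideal (cone_sgrp C') (push \<gamma>) = push ` right_ideal (cone_sgrp C) \<gamma>"
  unfolding right_ideal_def push_Elems_surj[symmetric] image_insert image_image
  using push_Mult[OF assms] by simp

lemma green_R_push:
  "(\<gamma>, \<delta>) \<in> green_R (cone_sgrp C) \<Longrightarrow> (push \<gamma>, push \<delta>) \<in> green_R (cone_sgrp C')"
  unfolding green_R_def using push_Elems right_ideal_push by auto

text \<open>The image has to be a whole R-class, not part of one: a cone related to
  \<open>push \<gamma>\<close> is \<open>push\<close> of its own pull, and that pull is related to
  \<open>\<gamma>\<close>.\<close>

lemma push_R_class:
  assumes "\<gamma> \<in> Elems (cone_sgrp C)"
  shows "push ` (green_R (cone_sgrp C) `` {\<gamma>}) = green_R (cone_sgrp C') `` {push \<gamma>}"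
proof (intro equalityI subsetI)
  interpret inv: normal_category_iso C' C Fo' Fa' Fo Fa by (rule converse)
  fix \<delta> assume "\<delta> \<in> green_R (cone_sgrp C') `` {push \<gamma>}"
  then have \<delta>: "(push \<gamma>, \<delta>) \<in> green_R (cone_sgrp C')"
    by simp
  then have "(\<gamma>, pull \<delta>) \<in> green_R (cone_sgrp C)"
    using inv.green_R_push[OF \<delta>] pull_push_Elems[OF assms] by simp
  moreover have "push (pull \<delta>) = \<delta>"
    using \<delta> by (intro inv.pull_push_Elems) (simp add: green_R_def)
  ultimately show "\<delta> \<in> push ` (green_R (cone_sgrp C) `` {\<gamma>})"
    by (intro image_eqI[of _ _ "pull \<delta>"]) simp_all
qed (use green_R_push in auto)

lemma cone_classes_push:
  assumes "d \<in> cone_classes C"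
  shows "push ` d \<in> cone_classes C'"
proof -
  from assms obtain \<gamma> where "\<gamma> \<in> Elems (cone_sgrp C)" "d = green_R (cone_sgrp C) `` {\<gamma>}"
    unfolding R_classes_def by (rule quotientE)
  then show ?thesis
    unfolding R_classes_def using push_R_class push_Elems by (simp add: quotientI)
qed

lemma cone_classes_Elems: "d \<in> cone_classes C \<Longrightarrow> d \<subseteq> Elems (cone_sgrp C)"
  unfolding R_classes_def quotient_def green_R_def by auto

lemma pull_push_class:
  assumes "d \<in> cone_classes C"
  shows "pull ` push ` d = d"
proof -
  have "pull (push \<gamma>) = \<gamma>" if "\<gamma> \<in> d" for \<gamma>
    using cone_classes_Elems[OF assms] that by (blast intro: pull_push_Elems)
  then show ?thesis
    by (simp add: image_image)
qed

lemma idempotent_cone_in_push: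
  assumes "idempotent_cone_in C c d \<gamma>"
  shows "idempotent_cone_in C' (Fo c) (push ` d) (push \<gamma>)"
proof -
  have \<gamma>: "\<gamma> \<in> d" "\<gamma> \<in> idempotents (cone_sgrp C)" "cone C c \<gamma>"
    using assms unfolding idempotent_cone_in_def by (auto simp: idempotents_def cone_sgrp_Elems)
  then show ?thesis
    unfolding idempotent_cone_in_def using push_idempotents vertex_push by blast
qed

text \<open>A class of cones goes to its image under \<open>push\<close>. Uniqueness of idempotent
  cones enters in the last condition, where the transported cone must be the one that
  \<open>idem_cone\<close> describes.\<close>

lemma CC_morphism: "CC_morphism C C' Fo Fa ((`) push)"
proof unfold_locales
  show "R_le (cone_sgrp C') (push ` d) (push ` e)"
    if "d \<in> cone_classes C" "e \<in> cone_classes C" "R_le (cone_sgrp C) d e" for d e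
  proof -
    from that(3) obtain \<gamma> \<delta> where *: "\<gamma> \<in> d" "\<delta> \<in> e"
      "right_ideal (cone_sgrp C) \<gamma> \<subseteq> right_ideal (cone_sgrp C) \<delta>"
      unfolding R_le_def by blast
    then have "\<gamma> \<in> Elems (cone_sgrp C)" "\<delta> \<in> Elems (cone_sgrp C)"
      using that cone_classes_Elems by blast+
    then have "right_ideal (cone_sgrp C') (push \<gamma>) \<subseteq> right_ideal (cone_sgrp C') (push \<delta>)"
      using *(3) by (simp add: right_ideal_push image_mono)
    then show ?thesis
      using *(1,2) unfolding R_le_def by blast
  qed
next
  fix c d assume "connected_to C c d"
  then show "connected_to C' (Fo c) (push ` d)"
    unfolding connected_to_def using F.F_Obj cone_classes_push idempotent_cone_in_push by blast
next
  fix c d c' assume "connected_to C c d" and c': "c' \<in> Obj C"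
  then obtain \<gamma> where d: "d \<in> cone_classes C" and \<gamma>: "idempotent_cone_in C c d \<gamma>"
    unfolding connected_to_def by blast
  have "idem_cone C c d = \<gamma>" "idem_cone C' (Fo c) (push ` d) = push \<gamma>"
    using C.idem_cone_eqI[OF \<gamma> d]
      C'.idem_cone_eqI[OF idempotent_cone_in_push[OF \<gamma>] cone_classes_push[OF d]] by blast+
  then show "Fa (idem_cone C c d c') = idem_cone C' (Fo c) (push ` d) (Fo c')"
    using c' by (simp add: push_cone_def F.F_Obj Fo'_Fo)
qed (rule cone_classes_push)

end

text \<open>Normality and a largest object are known for \<open>C\<close> and transported to
  \<open>C'\<close>. In the application \<open>C\<close> is the powerset category, whence the order
  of \<open>C'\<close> and \<open>C\<close> in the conclusion.\<close>

lemma (in category_iso) isomorphic_bounded_above: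
  assumes "bounded_above_normal_category C"
  shows "isomorphic_bounded_above C' C"
proof -
  interpret C: bounded_above_normal_category C by fact
  interpret C': normal_category C'
    using C.normal_category_axioms by (rule normal_category_transport)
  interpret normal_category_iso C C' Fo Fa Fo' Fa'
    using subobject_category_iso[OF C.category_with_subobjects_axioms]
      C.normal_category_axioms C'.normal_category_axioms by (simp add: normal_category_iso_def)
  interpret inv: normal_category_iso C' C Fo' Fa' Fo Fa by (rule converse)
  obtain d where d: "d \<in> Obj C" "\<And>c. c \<in> Obj C \<Longrightarrow> subobject C c d"
    using C.bounded_above by blast
  have "subobject C' c (Fo d)" if "c \<in> Obj C'" for c
    using subobject_Fo[OF d(2)[OF F'.F_Obj[OF that]]] that by (simp add: Fo_Fo')
  then have "bounded_above_normal_category C'"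
    using F.F_Obj[OF d(1)] by unfold_locales blast
  then show ?thesis
    unfolding isomorphic_bounded_above_def
    by (intro conjI assms exI[of _ Fo] exI[of _ Fa] exI[of _ "(`) push"]
        exI[of _ Fo'] exI[of _ Fa'] exI[of _ "(`) pull"] ballI CC_morphism inv.CC_morphism
        Fo'_Fo Fo_Fo' Fa'_Fa Fa_Fa' pull_push_class inv.pull_push_class)
qed

text \<open>All that is asked of \<open>C'\<close> is that it be the image of \<open>C\<close> under
  injective maps respecting the structure. The category axioms for \<open>L_cat\<close> are thus
  inherited from the powerset category, without computations in ideals.\<close>

lemma category_iso_of_image:
  assumes "category C" "Inc C \<subseteq> Arr C" "inj_on Fo (Obj C)" "inj_on Fa (Arr C)"
    and Obj: "Obj C' = Fo ` Obj C" and Arr: "Arr C' = Fa ` Arr C" and Inc: "Inc C' = Fa ` Inc C"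
    and Dom: "\<And>f. f \<in> Arr C \<Longrightarrow> Dom C' (Fa f) = Fo (Dom C f)"
    and Cod: "\<And>f. f \<in> Arr C \<Longrightarrow> Cod C' (Fa f) = Fo (Cod C f)"
    and Id: "\<And>c. c \<in> Obj C \<Longrightarrow> Fa (Id C c) = Id C' (Fo c)"
    and Comp: "\<And>f g. \<lbrakk>f \<in> Arr C; g \<in> Arr C; Cod C f = Dom C g\<rbrakk>
      \<Longrightarrow> Fa (f \<cdot>\<^bsub>C\<^esub> g) = Fa f \<cdot>\<^bsub>C'\<^esub> Fa g"
  shows "category_iso C C' Fo Fa (inv_into (Obj C) Fo) (inv_into (Arr C) Fa)"
proof -
  interpret C: category C by fact
  let ?Fo' = "inv_into (Obj C) Fo" and ?Fa' = "inv_into (Arr C) Fa"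
  have Fo'[simp]: "?Fo' (Fo c) = c" if "c \<in> Obj C" for c
    using assms(3) that by simp
  have Fa'[simp]: "?Fa' (Fa f) = f" if "f \<in> Arr C" for f
    using assms(4) that by simp
  have homI: "Fa f \<in> hom_set C' (Fo a) (Fo b)" if "f \<in> hom_set C a b" for f a b
    using that Dom Cod Arr by (auto simp: hom_set_def)
  \<comment> \<open>Injectivity of \<open>Fo\<close> recovers the ends of the preimage, so
    composable arrows of \<open>C'\<close> lift to composable arrows of \<open>C\<close>.\<close>
  have lift: "\<exists>f. f' = Fa f \<and> f \<in> hom_set C a b"
    if "f' \<in> hom_set C' (Fo a) (Fo b)" "a \<in> Obj C" "b \<in> Obj C" for f' a b
  proof -
    from that(1) obtain f where f: "f \<in> Arr C" "f' = Fa f"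
      by (auto simp: hom_set_def Arr)
    then have "Fo (Dom C f) = Fo a" "Fo (Cod C f) = Fo b"
      using that(1) Dom Cod by (auto simp: hom_set_def)
    then have "Dom C f = a" "Cod C f = b"
      using assms(3) C.Dom_in_Obj[OF f(1)] C.Cod_in_Obj[OF f(1)] that(2,3)
      by (auto dest: inj_onD)
    then show ?thesis
      using f by (auto simp: hom_set_def)
  qed
  have ends: "a' \<in> Fo ` Obj C \<and> b' \<in> Fo ` Obj C" if "f' \<in> hom_set C' a' b'" for f' a' b'
    using that Dom Cod C.Dom_in_Obj C.Cod_in_Obj by (auto simp: hom_set_def Arr)
  have Comp': "Fa f \<cdot>\<^bsub>C'\<^esub> Fa g = Fa (f \<cdot>\<^bsub>C\<^esub> g)"
    if "f \<in> hom_set C a b" "g \<in> hom_set C b c" for f g a b c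
    using that Comp by (auto simp: hom_set_def)
  interpret C': category C'
  proof
    fix f assume "f \<in> Arr C'"
    then show "Dom C' f \<in> Obj C'" "Cod C' f \<in> Obj C'"
      using ends[OF Arr_in_hom] by (auto simp: Obj)
  next
    fix c assume "c \<in> Obj C'"
    then show "Id C' c \<in> hom_set C' c c"
      using homI C.Id_in_hom by (auto simp: Obj Id[symmetric])
  next
    fix f g a b c assume *: "f \<in> hom_set C' a b" "g \<in> hom_set C' b c"
    then obtain a1 b1 c1 where o: "a = Fo a1" "b = Fo b1" "c = Fo c1"
      "a1 \<in> Obj C" "b1 \<in> Obj C" "c1 \<in> Obj C"
      using ends by blast
    then obtain f1 g1 where "f = Fa f1" "g = Fa g1" "f1 \<in> hom_set C a1 b1" "g1 \<in> hom_set C b1 c1"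
      using lift * by blast
    then show "f \<cdot>\<^bsub>C'\<^esub> g \<in> hom_set C' a c"
      using Comp' homI C.Comp_in_hom o by simp
  next
    fix f a b assume *: "f \<in> hom_set C' a b"
    then obtain a1 b1 where o: "a = Fo a1" "b = Fo b1" "a1 \<in> Obj C" "b1 \<in> Obj C"
      using ends by blast
    then obtain f1 where f: "f = Fa f1" "f1 \<in> hom_set C a1 b1"
      using lift * by blast
    show "Id C' a \<cdot>\<^bsub>C'\<^esub> f = f"
      using Comp'[OF C.Id_in_hom f(2)] C.Id_Comp[OF f(2)] o by (simp add: f Id[symmetric])
    show "f \<cdot>\<^bsub>C'\<^esub> Id C' b = f"
      using Comp'[OF f(2) C.Id_in_hom] C.Comp_Id[OF f(2)] o by (simp add: f Id[symmetric])
  next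
    fix f g h a b c d
    assume *: "f \<in> hom_set C' a b" "g \<in> hom_set C' b c" "h \<in> hom_set C' c d"
    then obtain a1 b1 c1 d1 where o: "a = Fo a1" "b = Fo b1" "c = Fo c1" "d = Fo d1"
      "a1 \<in> Obj C" "b1 \<in> Obj C" "c1 \<in> Obj C" "d1 \<in> Obj C"
      using ends by (meson imageE)
    then obtain f1 g1 where f: "f = Fa f1" "f1 \<in> hom_set C a1 b1"
      and g: "g = Fa g1" "g1 \<in> hom_set C b1 c1"
      using lift * by blast
    from o * obtain h1 where h: "h = Fa h1" "h1 \<in> hom_set C c1 d1"
      using lift by blast
    show "(f \<cdot>\<^bsub>C'\<^esub> g) \<cdot>\<^bsub>C'\<^esub> h = f \<cdot>\<^bsub>C'\<^esub> (g \<cdot>\<^bsub>C'\<^esub> h)"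
      using Comp'[OF f(2) g(2)] Comp'[OF g(2) h(2)] Comp'[OF C.Comp_in_hom[OF f(2) g(2)] h(2)]
        Comp'[OF f(2) C.Comp_in_hom[OF g(2) h(2)]] C.Comp_assoc[OF f(2) g(2) h(2)]
      by (simp add: f g h)
  qed
  show ?thesis
  proof unfold_locales
    fix f a b assume *: "f \<in> hom_set C' a b"
    then obtain a1 b1 where o: "a = Fo a1" "b = Fo b1" "a1 \<in> Obj C" "b1 \<in> Obj C"
      using ends by blast
    then obtain f1 where f: "f = Fa f1" "f1 \<in> hom_set C a1 b1"
      using lift * by blast
    then show "?Fa' f \<in> hom_set C (?Fo' a) (?Fo' b)"
      using o hom_setD(1)[OF f(2)] by simp
  next
    fix c assume "c \<in> Obj C'"
    then obtain c1 where c: "c1 \<in> Obj C" "c = Fo c1"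
      by (auto simp: Obj)
    then show "?Fa' (Id C' c) = Id C (?Fo' c)"
      using hom_setD(1)[OF C.Id_in_hom[OF c(1)]] by (simp add: Id[symmetric])
  next
    fix f g a b c assume *: "f \<in> hom_set C' a b" "g \<in> hom_set C' b c"
    then obtain a1 b1 c1 where o: "a = Fo a1" "b = Fo b1" "c = Fo c1"
      "a1 \<in> Obj C" "b1 \<in> Obj C" "c1 \<in> Obj C"
      using ends by blast
    then obtain f1 g1 where f: "f = Fa f1" "f1 \<in> hom_set C a1 b1"
      and g: "g = Fa g1" "g1 \<in> hom_set C b1 c1"
      using lift * by blast
    show "?Fa' (f \<cdot>\<^bsub>C'\<^esub> g) = ?Fa' f \<cdot>\<^bsub>C\<^esub> ?Fa' g"
      using f g C.Comp_in_hom[OF f(2) g(2)] by (simp add: Comp' hom_setD(1))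
  next
    show "Inc C' \<subseteq> Arr C'" "f \<in> Inc C' \<Longrightarrow> ?Fa' f \<in> Inc C" for f
      using assms(2) by (auto simp: Inc Arr subset_iff)
  qed (use assms(2) Obj Arr Inc homI Id Comp' in auto)
qed

section \<open>The powerset category\<close>

lemma powerset_cat_simps [simp]:
  "Obj (powerset_cat n) = {A. A \<subseteq> {1..n} \<and> A \<noteq> {}}"
  "Dom (powerset_cat n) (A, f, B) = A"
  "Cod (powerset_cat n) (A, f, B) = B"
  "Id (powerset_cat n) A = (A, (\<lambda>x\<in>A. x), A)"
  "(A, f, B) \<cdot>\<^bsub>powerset_cat n\<^esub> (B', g, D) = (A, (\<lambda>x\<in>A. g (f x)), D)"
  "Inc (powerset_cat n) =
     {(A, (\<lambda>x\<in>A. x), B) | A B. A \<noteq> {} \<and> A \<subseteq> B \<and> B \<subseteq> {1..n}}"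
proof -
  show "Inc (powerset_cat n) =
      {(A, (\<lambda>x\<in>A. x), B) | A B. A \<noteq> {} \<and> A \<subseteq> B \<and> B \<subseteq> {1..n}}"
    by (simp add: powerset_cat_def map_cat_def) blast
qed (auto simp: powerset_cat_def map_cat_def)

lemma powerset_cat_Arr:
  "Arr (powerset_cat n) =
     {(A, f, B) | A f B. A \<noteq> {} \<and> A \<subseteq> {1..n} \<and> B \<noteq> {} \<and> B \<subseteq> {1..n} \<and> f \<in> A \<rightarrow>\<^sub>E B}"
  by (auto simp: powerset_cat_def map_cat_def)

lemma powerset_cat_hom_set:
  "hom_set (powerset_cat n) A B =
     {(A, f, B) | f. A \<noteq> {} \<and> A \<subseteq> {1..n} \<and> B \<noteq> {} \<and> B \<subseteq> {1..n} \<and> f \<in> A \<rightarrow>\<^sub>E B}"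
  by (auto simp: hom_set_def powerset_cat_Arr)

text \<open>Extensionality of \<open>f\<close> turns both unit laws into equalities of functions. By
  the second, composing with any inclusion of \<open>B\<close> leaves the underlying function
  unchanged.\<close>

lemma PiE_comp_id:
  assumes "f \<in> A \<rightarrow>\<^sub>E B"
  shows "(\<lambda>x\<in>A. f ((\<lambda>x\<in>A. x) x)) = f" "(\<lambda>x\<in>A. (\<lambda>x\<in>B. x) (f x)) = f"
proof -
  have f: "f \<in> extensional A" "\<And>x. x \<in> A \<Longrightarrow> f x \<in> B"
    using assms by (auto simp: PiE_def)
  show "(\<lambda>x\<in>A. f ((\<lambda>x\<in>A. x) x)) = f" "(\<lambda>x\<in>A. (\<lambda>x\<in>B. x) (f x)) = f"
    by (rule extensionalityI[of _ A]; simp add: f)+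
qed

interpretation P: category "powerset_cat n" for n
proof
  show "f \<in> Arr (powerset_cat n) \<Longrightarrow> Dom (powerset_cat n) f \<in> Obj (powerset_cat n)"
    "f \<in> Arr (powerset_cat n) \<Longrightarrow> Cod (powerset_cat n) f \<in> Obj (powerset_cat n)" for f
    by (auto simp: powerset_cat_Arr)
  show "c \<in> Obj (powerset_cat n) \<Longrightarrow> Id (powerset_cat n) c \<in> hom_set (powerset_cat n) c c" for c
    by (auto simp: powerset_cat_hom_set)
  show "f \<cdot>\<^bsub>powerset_cat n\<^esub> g \<in> hom_set (powerset_cat n) a c"
    if "f \<in> hom_set (powerset_cat n) a b" "g \<in> hom_set (powerset_cat n) b c" for f g a b c
    using that by (auto simp: powerset_cat_hom_set PiE_def Pi_def)
  show "Id (powerset_cat n) a \<cdot>\<^bsub>powerset_cat n\<^esub> f = f"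
    "f \<cdot>\<^bsub>powerset_cat n\<^esub> Id (powerset_cat n) b = f"
    if "f \<in> hom_set (powerset_cat n) a b" for f a b
  proof -
    from that obtain k where k: "f = (a, k, b)" "k \<in> a \<rightarrow>\<^sub>E b"
      by (auto simp: powerset_cat_hom_set)
    show "Id (powerset_cat n) a \<cdot>\<^bsub>powerset_cat n\<^esub> f = f"
      "f \<cdot>\<^bsub>powerset_cat n\<^esub> Id (powerset_cat n) b = f"
      unfolding k(1) powerset_cat_simps PiE_comp_id[OF k(2)] by (rule refl)+
  qed
  show "(f \<cdot>\<^bsub>powerset_cat n\<^esub> g) \<cdot>\<^bsub>powerset_cat n\<^esub> h = f \<cdot>\<^bsub>powerset_cat n\<^esub> (g \<cdot>\<^bsub>powerset_cat n\<^esub> h)"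
    if "f \<in> hom_set (powerset_cat n) a b" "g \<in> hom_set (powerset_cat n) b c"
      "h \<in> hom_set (powerset_cat n) c d" for f g h a b c d
  proof -
    from that obtain f' g' h' where "f = (a, f', b)" "f' \<in> a \<rightarrow>\<^sub>E b" "g = (b, g', c)" "h = (c, h', d)"
      by (auto simp: powerset_cat_hom_set)
    then show ?thesis
      by (auto intro!: restrict_ext dest: PiE_mem)
  qed
qed

lemma powerset_cat_homI:
  assumes "A \<noteq> {}" "A \<subseteq> {1..n}" "B \<noteq> {}" "B \<subseteq> {1..n}" "\<And>x. x \<in> A \<Longrightarrow> f x \<in> B"
  shows "(A, (\<lambda>x\<in>A. f x), B) \<in> hom_set (powerset_cat n) A B"
proof -
  have "(\<lambda>x\<in>A. f x) \<in> A \<rightarrow>\<^sub>E B"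
    using assms(5) by simp
  then show ?thesis
    using assms(1-4) unfolding powerset_cat_hom_set by blast
qed

lemma powerset_cat_IncE:
  assumes "j \<in> Inc (powerset_cat n)"
  obtains A B where "j = (A, (\<lambda>x\<in>A. x), B)" "A \<noteq> {}" "A \<subseteq> B" "B \<subseteq> {1..n}"
  using assms unfolding powerset_cat_simps by blast

lemma powerset_cat_IncI:
  "\<lbrakk>A \<noteq> {}; A \<subseteq> B; B \<subseteq> {1..n}\<rbrakk> \<Longrightarrow> (A, (\<lambda>x\<in>A. x), B) \<in> Inc (powerset_cat n)"
  unfolding powerset_cat_simps by blast

lemma powerset_cat_inclusion_hom:
  "\<lbrakk>A \<noteq> {}; A \<subseteq> B; B \<subseteq> {1..n}\<rbrakk> \<Longrightarrow> (A, (\<lambda>x\<in>A. x), B) \<in> hom_set (powerset_cat n) A B"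
  by (rule powerset_cat_homI) blast+

text \<open>Inclusions are monic because composing with one keeps the underlying function. For the
  same reason, if \<open>f = h \<cdot> g\<close> with \<open>f\<close> and \<open>g\<close>
  inclusions, then \<open>h\<close> fixes each point of its domain, which is therefore contained in
  the domain of \<open>g\<close>.\<close>

interpretation P: category_with_subobjects "powerset_cat n" for n
proof
  show "monomorphism (powerset_cat n) j" if "j \<in> Inc (powerset_cat n)" for j
    unfolding monomorphism_def
  proof (intro conjI allI ballI impI)
    from that obtain A B where j: "j = (A, (\<lambda>x\<in>A. x), B)" "A \<noteq> {}" "A \<subseteq> B" "B \<subseteq> {1..n}"
      by (rule powerset_cat_IncE)
    show "j \<in> Arr (powerset_cat n)"
      unfolding j(1) using j(2-4) by (rule powerset_cat_inclusion_hom[THEN hom_setD(1)])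
    fix D g h assume "g \<in> hom_set (powerset_cat n) D (Dom (powerset_cat n) j)"
      "h \<in> hom_set (powerset_cat n) D (Dom (powerset_cat n) j)"
    then obtain g' h' where g: "g = (D, g', A)" "g' \<in> D \<rightarrow>\<^sub>E A" and h: "h = (D, h', A)" "h' \<in> D \<rightarrow>\<^sub>E A"
      by (auto simp: j powerset_cat_hom_set)
    assume "g \<cdot>\<^bsub>powerset_cat n\<^esub> j = h \<cdot>\<^bsub>powerset_cat n\<^esub> j"
    then have "(\<lambda>x\<in>D. (\<lambda>x\<in>A. x) (g' x)) = (\<lambda>x\<in>D. (\<lambda>x\<in>A. x) (h' x))"
      by (simp add: j g h)
    then show "g = h"
      unfolding PiE_comp_id[OF g(2)] PiE_comp_id[OF h(2)] by (simp add: g h)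
  qed
next
  fix f g h assume fg: "f \<in> Inc (powerset_cat n)" "g \<in> Inc (powerset_cat n)"
    and h: "h \<in> Arr (powerset_cat n)" "Cod (powerset_cat n) h = Dom (powerset_cat n) g"
      "f = h \<cdot>\<^bsub>powerset_cat n\<^esub> g"
  obtain D B where g: "g = (D, (\<lambda>x\<in>D. x), B)"
    using fg(2) by auto
  obtain A k D' where "h = (A, k, D')" "k \<in> A \<rightarrow>\<^sub>E D'" "A \<noteq> {}" "D' \<subseteq> {1..n}"
    using h(1) unfolding powerset_cat_Arr by blast
  moreover from this have "D' = D"
    using h(2) g by simp
  ultimately have hk: "h = (A, k, D)" "k \<in> A \<rightarrow>\<^sub>E D" "A \<noteq> {}" "D \<subseteq> {1..n}"
    by simp_all
  have "f = (A, (\<lambda>x\<in>A. (\<lambda>x\<in>D. x) (k x)), B)"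
    using h(3) by (simp only: g hk powerset_cat_simps)
  then have "(\<lambda>x\<in>A. (\<lambda>x\<in>D. x) (k x)) = (\<lambda>x\<in>A. x)"
    using fg(1) by auto
  then have k: "k = (\<lambda>x\<in>A. x)"
    unfolding PiE_comp_id[OF hk(2)] .
  then have "A \<subseteq> D"
    using hk(2) by (auto simp: PiE_def Pi_def)
  then show "h \<in> Inc (powerset_cat n)"
    using hk k by auto
next
  show "Inc (powerset_cat n) \<subseteq> Arr (powerset_cat n)"
    by (rule subsetI, erule powerset_cat_IncE, hypsubst)
      (rule powerset_cat_inclusion_hom[THEN hom_setD(1)])
  show "c \<in> Obj (powerset_cat n) \<Longrightarrow> Id (powerset_cat n) c \<in> Inc (powerset_cat n)" for c
    by auto
  fix f g assume "f \<in> Inc (powerset_cat n)" "g \<in> Inc (powerset_cat n)"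
  then obtain A B D E where f: "f = (A, (\<lambda>x\<in>A. x), B)" "A \<noteq> {}" "A \<subseteq> B" "B \<subseteq> {1..n}"
    and g: "g = (D, (\<lambda>x\<in>D. x), E)" "D \<noteq> {}" "D \<subseteq> E" "E \<subseteq> {1..n}"
    by (elim powerset_cat_IncE)
  show "f \<cdot>\<^bsub>powerset_cat n\<^esub> g \<in> Inc (powerset_cat n)" if "Cod (powerset_cat n) f = Dom (powerset_cat n) g"
  proof -
    have "f \<cdot>\<^bsub>powerset_cat n\<^esub> g = (A, (\<lambda>x\<in>A. x), E)"
      using that f g by (auto intro!: restrict_ext)
    then show ?thesis
      using that f g powerset_cat_IncI by simp
  qed
  show "f = g" if "Dom (powerset_cat n) f = Dom (powerset_cat n) g"
    "Cod (powerset_cat n) f = Cod (powerset_cat n) g"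
    using that by (simp add: f g)
  show "f = Id (powerset_cat n) (Dom (powerset_cat n) f)"
    if "Dom (powerset_cat n) g = Cod (powerset_cat n) f"
      "Cod (powerset_cat n) g = Dom (powerset_cat n) f"
    using that f(1,3) g(1,3) by simp
qed

text \<open>A fixed element of \<open>A\<close> receives all points outside \<open>A\<close>. Such a
  map splits inclusions, supplies a cone with prescribed vertex, and gives an idempotent with
  prescribed image.\<close>

lemma retract_onto:
  assumes "A \<noteq> {}"
  obtains r where "r ` X \<subseteq> A" "\<And>x. x \<in> A \<Longrightarrow> r x = x"
proof -
  obtain a where "a \<in> A"
    using assms by blast
  then show thesis
    using that[of "\<lambda>x. if x \<in> A then x else a"] by auto
qed

section \<open>Splittings, factorisations and cones in the powerset category\<close>

interpretation P: normal_category "powerset_cat n" for n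
proof
  fix j assume "j \<in> Inc (powerset_cat n)"
  then obtain A B where j: "j = (A, (\<lambda>x\<in>A. x), B)" "A \<noteq> {}" "A \<subseteq> B" "B \<subseteq> {1..n}"
    by (rule powerset_cat_IncE)
  obtain r where r: "r ` B \<subseteq> A" "\<And>x. x \<in> A \<Longrightarrow> r x = x"
    using retract_onto[OF j(2)] by blast
  have "(B, (\<lambda>x\<in>B. r x), A) \<in> hom_set (powerset_cat n) B A"
    using j r(1) by (intro powerset_cat_homI) blast+
  moreover have "(\<lambda>x\<in>A. (\<lambda>x\<in>B. r x) ((\<lambda>x\<in>A. x) x)) = (\<lambda>x\<in>A. x)"
    using j r(2) by (intro restrict_ext) auto
  ultimately have "retraction_of (powerset_cat n) j (B, (\<lambda>x\<in>B. r x), A)"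
    unfolding retraction_of_def j(1) using powerset_cat_IncI[OF j(2-4)]
    by (simp only: powerset_cat_simps(2-5))
  then show "splits (powerset_cat n) j"
    unfolding splits_def by blast
next
  fix \<phi> assume "\<phi> \<in> Arr (powerset_cat n)"
  then obtain A f B where \<phi>: "\<phi> = (A, f, B)" "A \<noteq> {}" "A \<subseteq> {1..n}" "B \<subseteq> {1..n}" "f \<in> A \<rightarrow>\<^sub>E B"
    unfolding powerset_cat_Arr by blast
  define s where "s = inv_into A f"
  have s: "s y \<in> A" "f (s y) = y" if "y \<in> f ` A" for y
    using that by (auto simp: s_def inv_into_into f_inv_into_f)
  define A' where "A' = s ` f ` A"
  have A': "A' \<subseteq> A" "A' \<noteq> {}" and fA: "f ` A \<subseteq> B"
    using s \<phi> by (auto simp: A'_def PiE_def Pi_def)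
  have sf: "s (f x) = x" if "x \<in> A'" for x
    using that s by (auto simp: A'_def)
  let ?q = "(A, (\<lambda>x\<in>A. s (f x)), A')" and ?u = "(A', (\<lambda>x\<in>A'. f x), f ` A)"
    and ?j = "(f ` A, (\<lambda>x\<in>f ` A. x), B)" and ?v = "(f ` A, (\<lambda>y\<in>f ` A. s y), A')"
  have q: "?q \<in> hom_set (powerset_cat n) A A'" and u: "?u \<in> hom_set (powerset_cat n) A' (f ` A)"
    and v: "?v \<in> hom_set (powerset_cat n) (f ` A) A'"
  proof -
    have "A' \<subseteq> {1..n}" "f ` A \<noteq> {}" "f ` A \<subseteq> {1..n}"
      using A' fA \<phi>(2-4) by blast+
    moreover have "s (f x) \<in> A'" if "x \<in> A" for x
      using that by (simp add: A'_def)
    moreover have "f x \<in> f ` A" if "x \<in> A'" for x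
      using that A'(1) by blast
    ultimately show "?q \<in> hom_set (powerset_cat n) A A'"
      "?u \<in> hom_set (powerset_cat n) A' (f ` A)" "?v \<in> hom_set (powerset_cat n) (f ` A) A'"
      using A'(2) \<phi>(2,3) by (intro powerset_cat_homI; blast)+
  qed
  have "(\<lambda>x\<in>A'. (\<lambda>x\<in>A. s (f x)) ((\<lambda>x\<in>A'. x) x)) = (\<lambda>x\<in>A'. x)"
    using A' sf by (intro restrict_ext) auto
  then have "retraction_of (powerset_cat n) (A', (\<lambda>x\<in>A'. x), A) ?q"
    unfolding retraction_of_def powerset_cat_simps(2-5)
    using q A' \<phi>(3) by (intro conjI powerset_cat_IncI) auto
  moreover have "isomorphism (powerset_cat n) ?u"
  proof -
    have "(\<lambda>x\<in>A'. (\<lambda>y\<in>f ` A. s y) ((\<lambda>x\<in>A'. f x) x)) = (\<lambda>x\<in>A'. x)"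
      "(\<lambda>y\<in>f ` A. (\<lambda>x\<in>A'. f x) ((\<lambda>y\<in>f ` A. s y) y)) = (\<lambda>y\<in>f ` A. y)"
      using A'(1) sf s by (auto intro!: restrict_ext simp: A'_def)
    then show ?thesis
      unfolding isomorphism_def powerset_cat_simps(2-5)
      using u v by (intro conjI bexI[of _ ?v]) (simp_all add: hom_setD(1))
  qed
  moreover have "?j \<in> Inc (powerset_cat n)"
    using \<phi> fA by (intro powerset_cat_IncI) auto
  moreover have "\<phi> = (?q \<cdot>\<^bsub>powerset_cat n\<^esub> ?u) \<cdot>\<^bsub>powerset_cat n\<^esub> ?j"
  proof -
    have "f = (\<lambda>x\<in>A. (\<lambda>x\<in>f ` A. x) ((\<lambda>x\<in>A. (\<lambda>x\<in>A'. f x) ((\<lambda>x\<in>A. s (f x)) x)) x))"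
      using \<phi>(5) s by (intro extensionalityI[of _ A]) (auto simp: A'_def PiE_def)
    then show ?thesis
      unfolding \<phi>(1) powerset_cat_simps by simp
  qed
  ultimately have "normal_factorisation (powerset_cat n) \<phi> ?q ?u ?j"
    unfolding normal_factorisation_def retraction_def powerset_cat_simps(2-3) by blast
  then show "\<exists>q u j. normal_factorisation (powerset_cat n) \<phi> q u j"
    by blast
next
  fix A assume "A \<in> Obj (powerset_cat n)"
  then have A: "A \<noteq> {}" "A \<subseteq> {1..n}"
    by auto
  obtain r where r: "r ` {1..n} \<subseteq> A" "\<And>x. x \<in> A \<Longrightarrow> r x = x"
    using retract_onto[OF A(1)] by blast
  \<comment> \<open>All components are restrictions of one retraction of \<open>{1..n}\<close> onto
    \<open>A\<close>: compatibility with inclusions is automatic, and the component at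
    \<open>A\<close> is the identity.\<close>
  define \<mu> where "\<mu> = (\<lambda>B\<in>Obj (powerset_cat n). (B, (\<lambda>x\<in>B. r x), A))"
  have Id: "\<mu> A = Id (powerset_cat n) A"
    using A r(2) by (auto simp: \<mu>_def intro!: restrict_ext)
  have hom: "\<mu> B \<in> hom_set (powerset_cat n) B A" if "B \<in> Obj (powerset_cat n)" for B
  proof -
    have B: "B \<noteq> {}" "B \<subseteq> {1..n}"
      using that by auto
    then have "(B, (\<lambda>x\<in>B. r x), A) \<in> hom_set (powerset_cat n) B A"
      using A r(1) by (intro powerset_cat_homI) blast+
    then show ?thesis
      using that by (simp add: \<mu>_def)
  qed
  have incl: "inclusion (powerset_cat n) D B \<cdot>\<^bsub>powerset_cat n\<^esub> \<mu> B = \<mu> D"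
    if "D \<in> Obj (powerset_cat n)" "B \<in> Obj (powerset_cat n)" "subobject (powerset_cat n) D B" for D B
  proof -
    have "D \<subseteq> B"
      using that(3) unfolding subobject_def by (auto simp: hom_set_def)
    then have "inclusion (powerset_cat n) D B = (D, (\<lambda>x\<in>D. x), B)"
      using that by (intro P.inclusion_eqI powerset_cat_inclusion_hom powerset_cat_IncI) simp_all
    then show ?thesis
      using that \<open>D \<subseteq> B\<close> by (auto simp: \<mu>_def intro!: restrict_ext)
  qed
  have "isomorphism (powerset_cat n) (\<mu> A)"
    unfolding Id using A by (intro P.isomorphism_Id) simp
  then have "cone (powerset_cat n) A \<mu>"
    unfolding cone_def using A hom incl
    by (intro conjI ballI impI bexI[of _ A]) (simp_all add: \<mu>_def)
  then show "\<exists>\<mu>. cone (powerset_cat n) A \<mu> \<and> \<mu> A = Id (powerset_cat n) A"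
    using Id by blast
qed

text \<open>The largest object is \<open>{1..n}\<close>, non-empty because \<open>n\<close> is
  positive.\<close>

lemma powerset_cat_bounded_above:
  assumes "n \<ge> 1"
  shows "bounded_above_normal_category (powerset_cat n)"
proof
  have "subobject (powerset_cat n) A {1..n}" if "A \<in> Obj (powerset_cat n)" for A
  proof -
    have "(A, (\<lambda>x\<in>A. x), {1..n}) \<in> hom_set (powerset_cat n) A {1..n} \<inter> Inc (powerset_cat n)"
      using that by (intro IntI powerset_cat_inclusion_hom powerset_cat_IncI) simp_all
    then show ?thesis
      unfolding subobject_def by blast
  qed
  then show "\<exists>d\<in>Obj (powerset_cat n). \<forall>c\<in>Obj (powerset_cat n). subobject (powerset_cat n) c d"
    using assms by (intro bexI[of _ "{1..n}"]) auto
qed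

section \<open>Left ideals of the full transformation monoid\<close>

lemma full_transformation_monoid_simps [simp]:
  "Elems (full_transformation_monoid n) = {1..n} \<rightarrow>\<^sub>E {1..n}"
  "Mult (full_transformation_monoid n) f g = (\<lambda>x\<in>{1..n}. g (f x))"
  by (simp_all add: full_transformation_monoid_def)

lemma idempotent_fixes_image:
  assumes "e \<in> idempotents (full_transformation_monoid n)" "x \<in> e ` {1..n}"
  shows "e x = x"
proof -
  obtain y where y: "y \<in> {1..n}" "x = e y"
    using assms(2) by blast
  have "(\<lambda>x\<in>{1..n}. e (e x)) = e"
    using assms(1) by (simp add: idempotents_def)
  from fun_cong[OF this, of y] show ?thesis
    using y by simp
qed

lemma idempotent_image:
  assumes "e \<in> idempotents (full_transformation_monoid n)" "n \<ge> 1"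
  shows "e ` {1..n} \<subseteq> {1..n}" "e ` {1..n} \<noteq> {}"
  using assms by (auto simp: idempotents_def)

text \<open>A retraction of \<open>{1..n}\<close> onto \<open>A\<close> is such an idempotent. This
  puts every \<open>maps_into n A\<close> with \<open>A\<close> as here among the objects of
  \<open>L_cat\<close>.\<close>

lemma ex_idempotent_with_image:
  assumes "A \<subseteq> {1..n}" "A \<noteq> {}"
  obtains e where "e \<in> idempotents (full_transformation_monoid n)" "e ` {1..n} = A"
proof -
  obtain r where r: "r ` {1..n} \<subseteq> A" "\<And>x. x \<in> A \<Longrightarrow> r x = x"
    using retract_onto[OF assms(2)] by blast
  define e where "e = (\<lambda>x\<in>{1..n}. r x)"
  have e: "e x = r x" "r x \<in> A" "e x \<in> {1..n}" if "x \<in> {1..n}" for x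
  proof -
    show "e x = r x"
      using that by (simp add: e_def)
    moreover show "r x \<in> A"
      using that r(1) by (rule subsetD[rotated, OF imageI])
    ultimately show "e x \<in> {1..n}"
      using assms(1) by (simp only: subsetD)
  qed
  have "(\<lambda>x\<in>{1..n}. e (e x)) = e"
    by (rule extensionalityI[of _ "{1..n}"]) (use e r(2) in \<open>auto simp: e_def\<close>)
  moreover have "e \<in> {1..n} \<rightarrow>\<^sub>E {1..n}"
    using e(3) by (intro PiE_I) (auto simp: e_def)
  ultimately have "e \<in> idempotents (full_transformation_monoid n)"
    by (simp add: idempotents_def)
  moreover have "e ` {1..n} = A"
  proof
    show "e ` {1..n} \<subseteq> A"
      by (rule image_subsetI) (simp only: e(1,2))
    show "A \<subseteq> e ` {1..n}"
    proof
      fix x assume "x \<in> A"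
      then have "x = e x" "x \<in> {1..n}"
        using r(2) e(1) assms(1) by auto
      then show "x \<in> e ` {1..n}"
        by (rule image_eqI)
    qed
  qed
  ultimately show thesis
    by (rule that)
qed

lemma left_ideal_full_transformation_monoid:
  assumes "e \<in> {1..n} \<rightarrow>\<^sub>E {1..n}"
  shows "left_ideal (full_transformation_monoid n) e = {1..n} \<rightarrow>\<^sub>E e ` {1..n}"
proof
  show "left_ideal (full_transformation_monoid n) e \<subseteq> {1..n} \<rightarrow>\<^sub>E e ` {1..n}"
    unfolding left_ideal_def full_transformation_monoid_simps
    by (intro image_subsetI) (simp only: restrict_PiE_iff, blast dest: PiE_mem)
  show "{1..n} \<rightarrow>\<^sub>E e ` {1..n} \<subseteq> left_ideal (full_transformation_monoid n) e"
  proof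
    fix x assume x: "x \<in> {1..n} \<rightarrow>\<^sub>E e ` {1..n}"
    \<comment> \<open>A map with values in the image of \<open>e\<close> is divisible by
      \<open>e\<close>: \<open>s\<close> picks preimages under \<open>e\<close> pointwise, so that
      \<open>x\<close> is \<open>s\<close> followed by \<open>e\<close>.\<close>
    define s where "s = (\<lambda>i\<in>{1..n}. inv_into {1..n} e (x i))"
    have s: "s i \<in> {1..n}" "e (s i) = x i" if "i \<in> {1..n}" for i
    proof -
      have "x i \<in> e ` {1..n}"
        using x that by (rule PiE_mem)
      then show "s i \<in> {1..n}" "e (s i) = x i"
        using that unfolding s_def by (simp_all only: restrict_apply' inv_into_into f_inv_into_f)
    qed
    have "s \<in> {1..n} \<rightarrow>\<^sub>E {1..n}"
      using s(1) by (intro PiE_I) (auto simp: s_def)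
    moreover have "x = (\<lambda>i\<in>{1..n}. e (s i))"
      using x s(2) by (intro extensionalityI[of _ "{1..n}"]) (auto simp: PiE_def)
    ultimately show "x \<in> left_ideal (full_transformation_monoid n) e"
      unfolding left_ideal_def by simp
  qed
qed

section \<open>The bijections on objects, arrows and inclusions\<close>

definition maps_into :: "nat \<Rightarrow> nat set \<Rightarrow> (nat \<Rightarrow> nat) set" where
  "maps_into n A = {1..n} \<rightarrow>\<^sub>E A"

fun postcompose :: "nat \<Rightarrow> nat map_arrow \<Rightarrow> (nat \<Rightarrow> nat) map_arrow" where
  "postcompose n (A, g, B) =
     (maps_into n A, (\<lambda>x\<in>maps_into n A. \<lambda>i\<in>{1..n}. g (x i)), maps_into n B)"

text \<open>A point of \<open>A\<close> is detected by the constant map at that point; positivity of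
  \<open>n\<close> provides the argument 1 at which the constant map is evaluated.\<close>

lemma maps_into_subset_iff:
  assumes "n \<ge> 1"
  shows "maps_into n A \<subseteq> maps_into n B \<longleftrightarrow> A \<subseteq> B"
proof
  assume sub: "maps_into n A \<subseteq> maps_into n B"
  show "A \<subseteq> B"
  proof
    fix a assume "a \<in> A"
    then have "(\<lambda>i\<in>{1..n}. a) \<in> maps_into n A"
      by (simp add: maps_into_def)
    then have "(\<lambda>i\<in>{1..n}. a) \<in> maps_into n B"
      using sub by (rule subsetD[rotated])
    then have "(\<lambda>i\<in>{1..n}. a) 1 \<in> B"
      unfolding maps_into_def using assms by (auto dest: PiE_mem)
    then show "a \<in> B"
      using assms by simp
  qed
qed (auto simp: maps_into_def PiE_def)

lemma inj_maps_into: "n \<ge> 1 \<Longrightarrow> inj (maps_into n)"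
  by (rule injI) (metis maps_into_subset_iff subset_antisym order_refl)

text \<open>The ends are recovered from the ideals, as \<open>maps_into n\<close> is injective. The
  value at \<open>a\<close> is recovered from the action on the constant map at
  \<open>a\<close>.\<close>

lemma inj_on_postcompose:
  assumes "n \<ge> 1"
  shows "inj_on (postcompose n) (Arr (powerset_cat n))"
proof (rule inj_onI)
  fix \<phi> \<psi> assume "\<phi> \<in> Arr (powerset_cat n)" "\<psi> \<in> Arr (powerset_cat n)"
    and eq: "postcompose n \<phi> = postcompose n \<psi>"
  then obtain A f B D g E where \<phi>: "\<phi> = (A, f, B)" "f \<in> A \<rightarrow>\<^sub>E B" and \<psi>: "\<psi> = (D, g, E)" "g \<in> D \<rightarrow>\<^sub>E E"
    unfolding powerset_cat_Arr by blast
  have [simp]: "D = A" "E = B"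
    using eq inj_maps_into[OF assms] by (auto simp: \<phi> \<psi> dest: injD)
  have "f a = g a" if "a \<in> A" for a
  proof -
    let ?a = "\<lambda>i\<in>{1..n}. a"
    have a: "?a \<in> maps_into n A"
      using that by (simp add: maps_into_def)
    have "(\<lambda>x\<in>maps_into n A. \<lambda>i\<in>{1..n}. f (x i)) = (\<lambda>x\<in>maps_into n A. \<lambda>i\<in>{1..n}. g (x i))"
      using eq by (simp add: \<phi> \<psi>)
    from fun_cong[OF this, of ?a] have "(\<lambda>i\<in>{1..n}. f (?a i)) = (\<lambda>i\<in>{1..n}. g (?a i))"
      using a by (simp only: restrict_apply')
    from fun_cong[OF this, of 1] show ?thesis
      using assms by simp
  qed
  then have "f = g"
    using \<phi>(2) \<psi>(2) by (intro PiE_ext[of f A "\<lambda>_. B"]) simp_all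
  then show "\<phi> = \<psi>"
    by (simp add: \<phi> \<psi>)
qed

lemma L_cat_simps:
  "Dom (L_cat S) (A, f, B) = A" "Cod (L_cat S) (A, f, B) = B"
  "Id (L_cat S) A = (A, (\<lambda>x\<in>A. x), A)"
  "(A, f, B) \<cdot>\<^bsub>L_cat S\<^esub> (B', g, D) = (A, (\<lambda>x\<in>A. g (f x)), D)"
  by (simp_all add: L_cat_def map_cat_def)

lemma left_ideal_idempotent:
  "e \<in> idempotents (full_transformation_monoid n) \<Longrightarrow>
    left_ideal (full_transformation_monoid n) e = maps_into n (e ` {1..n})"
  unfolding maps_into_def
  by (rule left_ideal_full_transformation_monoid) (simp add: idempotents_def)

lemma L_cat_Obj:
  assumes "n \<ge> 1"
  shows "Obj (L_cat (full_transformation_monoid n)) = maps_into n ` Obj (powerset_cat n)"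
proof -
  let ?S = "full_transformation_monoid n"
  have "left_ideal ?S ` idempotents ?S = maps_into n ` {A. A \<subseteq> {1..n} \<and> A \<noteq> {}}"
  proof (intro equalityI image_subsetI)
    fix e assume e: "e \<in> idempotents ?S"
    show "left_ideal ?S e \<in> maps_into n ` {A. A \<subseteq> {1..n} \<and> A \<noteq> {}}"
      unfolding left_ideal_idempotent[OF e] using idempotent_image[OF e assms] by blast
  next
    fix A assume "A \<in> {A. A \<subseteq> {1..n} \<and> A \<noteq> {}}"
    then obtain e where "e \<in> idempotents ?S" "e ` {1..n} = A"
      using ex_idempotent_with_image by blast
    then show "maps_into n A \<in> left_ideal ?S ` idempotents ?S"
      using left_ideal_idempotent by blast
  qed
  then show ?thesis
    by (simp add: L_cat_def map_cat_def)
qed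

text \<open>Members of the ideal of \<open>e\<close> take values in the image of \<open>e\<close>,
  so a translation sees \<open>u\<close> only there. Hence \<open>u\<close> may be replaced by its
  restriction to that image, or by the map between images that it is meant to realise.\<close>

lemma right_translation_postcompose:
  assumes "e \<in> idempotents (full_transformation_monoid n)"
    and "f \<in> idempotents (full_transformation_monoid n)"
    and "\<And>a. a \<in> e ` {1..n} \<Longrightarrow> u a = g a"
  shows "right_translation (full_transformation_monoid n) e u f =
    postcompose n (e ` {1..n}, g, f ` {1..n})"
proof -
  have "(\<lambda>i\<in>{1..n}. u (x i)) = (\<lambda>i\<in>{1..n}. g (x i))" if "x \<in> maps_into n (e ` {1..n})" for x
    using that assms(3) unfolding maps_into_def by (intro restrict_ext) (blast dest: PiE_mem)
  then have "(\<lambda>x\<in>maps_into n (e ` {1..n}). \<lambda>i\<in>{1..n}. u (x i))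
      = (\<lambda>x\<in>maps_into n (e ` {1..n}). \<lambda>i\<in>{1..n}. g (x i))"
    by (rule restrict_ext)
  then show ?thesis
    unfolding right_translation_def left_ideal_idempotent[OF assms(1)]
      left_ideal_idempotent[OF assms(2)] full_transformation_monoid_simps postcompose.simps
    by (simp only:)
qed

lemma L_cat_Arr:
  assumes "n \<ge> 1"
  shows "Arr (L_cat (full_transformation_monoid n)) = postcompose n ` Arr (powerset_cat n)"
proof (intro equalityI subsetI)
  let ?S = "full_transformation_monoid n"
  fix \<phi> assume "\<phi> \<in> Arr (L_cat ?S)"
  then obtain e u f s where e: "e \<in> idempotents ?S" and f: "f \<in> idempotents ?S"
    and s: "s \<in> {1..n} \<rightarrow>\<^sub>E {1..n}" and u: "u = Mult ?S (Mult ?S e s) f"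
    and \<phi>: "\<phi> = right_translation ?S e u f"
    unfolding L_cat_def map_cat_def by auto
  let ?A = "e ` {1..n}" and ?B = "f ` {1..n}"
  have im: "?A \<subseteq> {1..n}" "?A \<noteq> {}" "?B \<subseteq> {1..n}" "?B \<noteq> {}"
    using idempotent_image e f assms by blast+
  \<comment> \<open>The last factor of \<open>u\<close> is \<open>f\<close>, so its values lie in
    the image of \<open>f\<close>.\<close>
  have "u i \<in> ?B" if "i \<in> ?A" for i
  proof -
    have "i \<in> {1..n}" "e i \<in> {1..n}"
      using that im by blast+
    moreover from this have "s (e i) \<in> {1..n}"
      using s by (blast dest: PiE_mem)
    ultimately show ?thesis
      by (simp add: u)
  qed
  then have "(?A, (\<lambda>x\<in>?A. u x), ?B) \<in> Arr (powerset_cat n)"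
    using im by (intro hom_setD(1)[OF powerset_cat_homI])
  moreover have "\<phi> = postcompose n (?A, (\<lambda>x\<in>?A. u x), ?B)"
    unfolding \<phi> using e f by (rule right_translation_postcompose) (simp only: restrict_apply')
  ultimately show "\<phi> \<in> postcompose n ` Arr (powerset_cat n)"
    by (rule rev_image_eqI)
next
  let ?S = "full_transformation_monoid n"
  fix \<phi> assume "\<phi> \<in> postcompose n ` Arr (powerset_cat n)"
  then obtain A g B where \<phi>: "\<phi> = postcompose n (A, g, B)" and g: "g \<in> A \<rightarrow>\<^sub>E B"
    and AB: "A \<subseteq> {1..n}" "A \<noteq> {}" "B \<subseteq> {1..n}" "B \<noteq> {}"
    unfolding powerset_cat_Arr by blast
  obtain e where e: "e \<in> idempotents ?S" "e ` {1..n} = A"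
    using AB(1,2) by (rule ex_idempotent_with_image)
  obtain f where f: "f \<in> idempotents ?S" "f ` {1..n} = B"
    using AB(3,4) by (rule ex_idempotent_with_image)
  \<comment> \<open>The map \<open>g\<close> is extended to \<open>{1..n}\<close> by applying
    \<open>e\<close> first. Then \<open>u\<close> agrees with \<open>g\<close> on \<open>A\<close>,
    which \<open>e\<close> fixes pointwise. Multiplying \<open>u\<close> by \<open>e\<close> on the
    left and \<open>f\<close> on the right returns \<open>u\<close>, since \<open>e\<close> is
    idempotent and \<open>f\<close> fixes \<open>B\<close> pointwise; so \<open>u\<close> is its own
    witness for membership in \<open>eSf\<close>.\<close>
  define u where "u = (\<lambda>i\<in>{1..n}. g (e i))"
  have eA: "e i \<in> A" "e i \<in> {1..n}" "e (e i) = e i" if "i \<in> {1..n}" for i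
    using that e AB(1) idempotent_fixes_image[OF e(1)] by blast+
  have gB: "g a \<in> B" "f (g a) = g a" if "a \<in> A" for a
    using that g f idempotent_fixes_image[OF f(1)] by (blast dest: PiE_mem)+
  have "u \<in> {1..n} \<rightarrow>\<^sub>E {1..n}"
    unfolding u_def restrict_PiE_iff using eA(1) gB(1) AB(3) by blast
  moreover have "u = Mult ?S (Mult ?S e u) f"
    unfolding u_def using eA gB by (auto intro!: restrict_ext)
  ultimately have "u \<in> (\<lambda>s. Mult ?S (Mult ?S e s) f) ` Elems ?S"
    by (intro image_eqI[of u _ u]) simp_all
  moreover have "\<phi> = right_translation ?S e u f"
  proof -
    have "u a = g a" if "a \<in> e ` {1..n}" for a
      using that idempotent_fixes_image[OF e(1) that] e(2) AB(1) by (auto simp: u_def)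
    from right_translation_postcompose[OF e(1) f(1) this] show ?thesis
      by (simp only: \<phi> e(2) f(2))
  qed
  ultimately show "\<phi> \<in> Arr (L_cat ?S)"
    unfolding L_cat_def map_cat_def using e(1) f(1) by simp blast
qed

text \<open>An idempotent is the identity on its image, so translation by \<open>e\<close> is
  postcomposition with an inclusion of images; containment of ideals is containment of
  images.\<close>

lemma L_cat_Inc:
  assumes "n \<ge> 1"
  shows "Inc (L_cat (full_transformation_monoid n)) = postcompose n ` Inc (powerset_cat n)"
proof -
  let ?S = "full_transformation_monoid n"
  have incl: "right_translation ?S e e f = postcompose n (e ` {1..n}, (\<lambda>x\<in>e ` {1..n}. x), f ` {1..n})"
    if "e \<in> idempotents ?S" "f \<in> idempotents ?S" for e f
    using that by (rule right_translation_postcompose)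
      (simp only: idempotent_fixes_image[OF that(1)] restrict_apply')
  have sub: "left_ideal ?S e \<subseteq> left_ideal ?S f \<longleftrightarrow> e ` {1..n} \<subseteq> f ` {1..n}"
    if "e \<in> idempotents ?S" "f \<in> idempotents ?S" for e f
    using that by (simp only: left_ideal_idempotent maps_into_subset_iff[OF assms])
  have "{right_translation ?S e e f | e f. e \<in> idempotents ?S \<and> f \<in> idempotents ?S \<and>
      left_ideal ?S e \<subseteq> left_ideal ?S f} = postcompose n ` Inc (powerset_cat n)"
  proof (intro equalityI subsetI)
    fix \<phi> assume "\<phi> \<in> {right_translation ?S e e f | e f. e \<in> idempotents ?S \<and>
      f \<in> idempotents ?S \<and> left_ideal ?S e \<subseteq> left_ideal ?S f}"
    then obtain e f where *: "e \<in> idempotents ?S" "f \<in> idempotents ?S"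
      "left_ideal ?S e \<subseteq> left_ideal ?S f" "\<phi> = right_translation ?S e e f"
      by blast
    then show "\<phi> \<in> postcompose n ` Inc (powerset_cat n)"
      unfolding *(4) incl[OF *(1,2)] sub[OF *(1,2)]
      using idempotent_image(2)[OF *(1) assms] idempotent_image(1)[OF *(2) assms]
      by (intro imageI powerset_cat_IncI)
  next
    fix \<phi> assume "\<phi> \<in> postcompose n ` Inc (powerset_cat n)"
    then obtain j where "j \<in> Inc (powerset_cat n)" "\<phi> = postcompose n j"
      by blast
    then obtain A B where \<phi>: "\<phi> = postcompose n (A, (\<lambda>x\<in>A. x), B)"
      and AB: "A \<noteq> {}" "A \<subseteq> B" "B \<subseteq> {1..n}"
      by (metis powerset_cat_IncE)
    have "A \<subseteq> {1..n}" "B \<noteq> {}"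
      using AB by blast+
    then obtain e f where e: "e \<in> idempotents ?S" "e ` {1..n} = A"
      and f: "f \<in> idempotents ?S" "f ` {1..n} = B"
      using AB(1,3) by (metis ex_idempotent_with_image)
    have "\<phi> = right_translation ?S e e f" "left_ideal ?S e \<subseteq> left_ideal ?S f"
      using incl[OF e(1) f(1)] sub[OF e(1) f(1)] AB(2) by (simp_all only: \<phi> e f)
    then show "\<phi> \<in> {right_translation ?S e e f | e f. e \<in> idempotents ?S \<and>
        f \<in> idempotents ?S \<and> left_ideal ?S e \<subseteq> left_ideal ?S f}"
      using e(1) f(1) by blast
  qed
  then show ?thesis
    by (simp only: L_cat_def map_cat_def cat.simps)
qed

theorem proposition7p9:
  fixes n :: nat
  assumes "n \<ge> 1"
  shows "isomorphic_bounded_above (L_cat (full_transformation_monoid n)) (powerset_cat n)"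
proof -
  let ?L = "L_cat (full_transformation_monoid n)" and ?P = "powerset_cat n"
  have "category_iso ?P ?L (maps_into n) (postcompose n)
    (inv_into (Obj ?P) (maps_into n)) (inv_into (Arr ?P) (postcompose n))"
  proof (rule category_iso_of_image)
    show "category ?P" "Inc ?P \<subseteq> Arr ?P"
      by (rule P.category_axioms P.Inc_subset)+
    show "inj_on (maps_into n) (Obj ?P)"
      using inj_maps_into[OF assms] by (rule inj_on_subset) simp
    show "inj_on (postcompose n) (Arr ?P)"
      using assms by (rule inj_on_postcompose)
    show "Obj ?L = maps_into n ` Obj ?P" "Arr ?L = postcompose n ` Arr ?P"
      "Inc ?L = postcompose n ` Inc ?P"
      using assms by (rule L_cat_Obj L_cat_Arr L_cat_Inc)+
    show "Dom ?L (postcompose n \<phi>) = maps_into n (Dom ?P \<phi>)"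
      "Cod ?L (postcompose n \<phi>) = maps_into n (Cod ?P \<phi>)" for \<phi>
      by (cases \<phi>; simp add: L_cat_simps)+
    show "postcompose n (Id ?P A) = Id ?L (maps_into n A)" for A
    proof -
      have "(\<lambda>i\<in>{1..n}. (\<lambda>a\<in>A. a) (x i)) = x" if "x \<in> maps_into n A" for x
        using that unfolding maps_into_def by (rule PiE_comp_id)
      then have "(\<lambda>x\<in>maps_into n A. \<lambda>i\<in>{1..n}. (\<lambda>a\<in>A. a) (x i)) = (\<lambda>x\<in>maps_into n A. x)"
        by (rule restrict_ext)
      then show ?thesis
        by (simp only: powerset_cat_simps postcompose.simps L_cat_simps)
    qed
    show "postcompose n (\<phi> \<cdot>\<^bsub>?P\<^esub> \<psi>) = postcompose n \<phi> \<cdot>\<^bsub>?L\<^esub> postcompose n \<psi>"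
      if arr: "\<phi> \<in> Arr ?P" "\<psi> \<in> Arr ?P" "Cod ?P \<phi> = Dom ?P \<psi>" for \<phi> \<psi>
    proof -
      obtain A f B D g E where \<phi>: "\<phi> = (A, f, B)" "f \<in> A \<rightarrow>\<^sub>E B" and \<psi>: "\<psi> = (D, g, E)"
        using arr(1,2) unfolding powerset_cat_Arr by blast
      have [simp]: "D = B"
        using arr(3) by (simp add: \<phi> \<psi>)
      have "(\<lambda>i\<in>{1..n}. (\<lambda>a\<in>A. g (f a)) (x i))
          = (\<lambda>x\<in>maps_into n B. \<lambda>i\<in>{1..n}. g (x i)) (\<lambda>i\<in>{1..n}. f (x i))"
        if x: "x \<in> maps_into n A" for x
      proof -
        have A: "x i \<in> A" if "i \<in> {1..n}" for i
          using x that unfolding maps_into_def by (rule PiE_mem)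
        \<comment> \<open>The map \<open>x\<close> followed by \<open>f\<close> lies in the domain
          of the second translation, so the restriction there can be evaluated; both sides then send
          \<open>i\<close> to \<open>g (f (x i))\<close>.\<close>
        then have "(\<lambda>i\<in>{1..n}. f (x i)) \<in> maps_into n B"
          unfolding maps_into_def using \<phi>(2) by (auto dest: PiE_mem)
        then show ?thesis
          using A by (auto intro!: restrict_ext)
      qed
      then have "(\<lambda>x\<in>maps_into n A. \<lambda>i\<in>{1..n}. (\<lambda>a\<in>A. g (f a)) (x i))
          = (\<lambda>x\<in>maps_into n A. (\<lambda>x\<in>maps_into n B. \<lambda>i\<in>{1..n}. g (x i))
              ((\<lambda>x\<in>maps_into n A. \<lambda>i\<in>{1..n}. f (x i)) x))"
        by (intro restrict_ext) (simp only: restrict_apply')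
      then show ?thesis
        unfolding \<phi>(1) \<psi> \<open>D = B\<close>
        by (simp only: powerset_cat_simps postcompose.simps L_cat_simps)
    qed
  qed
  then show ?thesis
    using powerset_cat_bounded_above[OF assms] by (rule category_iso.isomorphic_bounded_above)
qed

end
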